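(* Let $\lambda\in[0,1)$, $\delta>0$, let $(\alpha,S)$ be a phase-type job size distribution with mean $1$, and let $y=\alpha(\delta I-S)^{-1}s^*$ (equivalently $y=P[Z<X]$). Put $$\tilde m=\frac{\log\left(\frac1y+\left(\frac{\lambda}{\delta(1-\lambda)}-1\right)\cdot\frac{1-y}{y}\right)}{\log(1/y)} .$$ Then $1-\lambda\in[\pi_0(\lceil\tilde m\rceil),\pi_0(\lfloor\tilde m\rfloor)]$, where $\pi_0(m)=\pi_0(m,0)$. Consequently $\lceil\tilde m\rceil$ is the maximum queue length of the queue at the cavity of the push policy.
   Context: Job sizes: $Z$ has a phase-type (PH) distribution $(\alpha,S)$, where $\alpha$ is a probability row vector of length $n_s$, $S$ is an invertible $n_s\times n_s$ subgenerator matrix, $s^*=-S\mathbf 1$ ($\mathbf 1$ the all-ones column), $P[Z>t]=\alpha e^{St}\mathbf 1$, and $E[Z]=\alpha(-S)^{-1}\mathbf 1=1$. $X$ is exponential with rate $\delta$, independent of $Z$. Push policy chain: for an integer $m\ge 0$ and a real $\nu\ge 0$, consider the continuous-time Markov chain on the states $(0,e)$ and $(q,e,j)$ with $e\in\{m,m+1\}$, $1\le q\le e$, $1\le j\le n_s$ ($q$ = actual queue length, $e$ = estimated queue length, $j$ = service phase), with the following transitions. (i) Phase changes: $(q,e,j)\to(q,e,j')$ at rate $S_{jj'}$ for $j\ne j'$. (ii) Service completions: $(q,e,j)\to(q-1,e,j')$ at rate $s^*_j\alpha_{j'}$ if $q\ge2$; $(1,e,j)\to(0,e)$ at rate $s^*_j$.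 (iii) Probes: $(q,e,j)\to(\max(q,m),\max(q,m),j)$ at rate $\delta$; $(0,e)\to(m,m,j')$ at rate $\delta\alpha_{j'}$ if $m\ge1$ (if $m=0$: $(0,e)\to(0,0)$ at rate $\delta$). (iv) Job assignments: $(q,m,j)\to(q+1,m+1,j)$ at rate $\nu$ for $q\ge1$; $(0,m)\to(1,m+1,j')$ at rate $\nu\alpha_{j'}$. Let $\pi_q(m,\nu)$ be the stationary probability that the actual queue length is $q$; in particular $\pi_0(0,0)=1$. When $\nu=0$, states with $e=m+1$ are transient. Queue at the cavity: the stationary chain for the unique pair $(m,\nu)$, $m\in\{0,1,2,\dots\}$, $\nu\in[0,\infty)$, with $\pi_0(m,\nu)=1-\lambda$. Its maximum queue length is the largest $q$ with $\pi_q(m,\nu)>0$. *)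

theory Defs
  imports "HOL-Analysis.Analysis"
begin

(* Phases are the elements of a finite type 'n, so n_s = CARD('n). A row vector times a column
   vector is written as an inner product. In real ^ 'n the constant 1 is the all-ones vector, and
   mat c is c times the identity matrix. *)

definition subgenerator :: "real ^ 'n ^ 'n \<Rightarrow> bool" where
  "subgenerator S \<longleftrightarrow>
     (\<forall>i. S $ i $ i \<le> 0) \<and> (\<forall>i j. i \<noteq> j \<longrightarrow> 0 \<le> S $ i $ j) \<and> (\<forall>i. (\<Sum>j\<in>UNIV. S $ i $ j) \<le> 0)"

definition phase_type :: "real ^ 'n \<Rightarrow> real ^ 'n ^ 'n \<Rightarrow> bool" where
  "phase_type \<alpha> S \<longleftrightarrow>
     (\<forall>i. 0 \<le> \<alpha> $ i) \<and> (\<Sum>i\<in>UNIV. \<alpha> $ i) = 1 \<and> subgenerator S \<and> invertible S"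

definition exit_rates :: "real ^ 'n ^ 'n \<Rightarrow> real ^ 'n" where
  "exit_rates S = (- S) *v 1"

definition ph_mean :: "real ^ 'n \<Rightarrow> real ^ 'n ^ 'n \<Rightarrow> real" where
  "ph_mean \<alpha> S = (\<alpha> v* matrix_inv (- S)) \<bullet> 1"

definition ph_before_exp :: "real ^ 'n \<Rightarrow> real ^ 'n ^ 'n \<Rightarrow> real \<Rightarrow> real" where
  "ph_before_exp \<alpha> S \<delta> = (\<alpha> v* matrix_inv (mat \<delta> - S)) \<bullet> exit_rates S"

(* Idle e is the state (0,e); Busy q e j is the state (q,e,j). *)

datatype 'n state = Idle nat | Busy nat nat 'n

fun queue_length :: "'n state \<Rightarrow> nat" where
  "queue_length (Idle e) = 0"
| "queue_length (Busy q e j) = q"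

definition push_states :: "nat \<Rightarrow> 'n state set" where
  "push_states m =
     {Idle e | e. e \<in> {m, m + 1}} \<union> {Busy q e j | q e j. e \<in> {m, m + 1} \<and> 1 \<le> q \<and> q \<le> e}"

(* Transition rates. Each summand is one kind of transition: phase change, service completion,
   probe, job assignment. A probe that changes nothing yields a self-loop, which has no effect
   on the balance equations. *)

fun push_rate ::
  "real ^ 'n \<Rightarrow> real ^ 'n ^ 'n \<Rightarrow> real \<Rightarrow> nat \<Rightarrow> real \<Rightarrow> 'n state \<Rightarrow> 'n state \<Rightarrow> real"
where
  "push_rate \<alpha> S \<delta> m \<nu> (Busy q e j) (Busy q' e' j') =
     (if q' = q \<and> e' = e \<and> j' \<noteq> j then S $ j $ j' else 0)
   + (if 2 \<le> q \<and> q' = q - 1 \<and> e' = e then exit_rates S $ j * \<alpha> $ j' else 0)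
   + (if q' = max q m \<and> e' = max q m \<and> j' = j then \<delta> else 0)
   + (if e = m \<and> q' = q + 1 \<and> e' = m + 1 \<and> j' = j then \<nu> else 0)"
| "push_rate \<alpha> S \<delta> m \<nu> (Busy q e j) (Idle e') =
     (if q = 1 \<and> e' = e then exit_rates S $ j else 0)"
| "push_rate \<alpha> S \<delta> m \<nu> (Idle e) (Busy q' e' j') =
     (if 1 \<le> m \<and> q' = m \<and> e' = m then \<delta> * \<alpha> $ j' else 0)
   + (if e = m \<and> q' = 1 \<and> e' = m + 1 then \<nu> * \<alpha> $ j' else 0)"
| "push_rate \<alpha> S \<delta> m \<nu> (Idle e) (Idle e') =
     (if m = 0 \<and> e' = 0 then \<delta> else 0)"

definition push_stationary ::
  "real ^ 'n \<Rightarrow> real ^ 'n ^ 'n \<Rightarrow> real \<Rightarrow> nat \<Rightarrow> real \<Rightarrow> ('n state \<Rightarrow> real) \<Rightarrow> bool"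
where
  "push_stationary \<alpha> S \<delta> m \<nu> p \<longleftrightarrow>
     (\<forall>s. 0 \<le> p s) \<and> (\<forall>s. s \<notin> push_states m \<longrightarrow> p s = 0) \<and> (\<Sum>s\<in>push_states m. p s) = 1 \<and>
     (\<forall>s\<in>push_states m.
        p s * (\<Sum>s'\<in>push_states m. push_rate \<alpha> S \<delta> m \<nu> s s')
          = (\<Sum>s'\<in>push_states m. p s' * push_rate \<alpha> S \<delta> m \<nu> s' s))"

definition push_dist ::
  "real ^ 'n \<Rightarrow> real ^ 'n ^ 'n \<Rightarrow> real \<Rightarrow> nat \<Rightarrow> real \<Rightarrow> 'n state \<Rightarrow> real"
where
  "push_dist \<alpha> S \<delta> m \<nu> = (THE p. push_stationary \<alpha> S \<delta> m \<nu> p)"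

definition queue_prob ::
  "real ^ 'n \<Rightarrow> real ^ 'n ^ 'n \<Rightarrow> real \<Rightarrow> nat \<Rightarrow> real \<Rightarrow> nat \<Rightarrow> real"
where
  "queue_prob \<alpha> S \<delta> m \<nu> q =
     (\<Sum>s\<in>{s \<in> push_states m. queue_length s = q}. push_dist \<alpha> S \<delta> m \<nu> s)"

definition cavity_params ::
  "real ^ 'n \<Rightarrow> real ^ 'n ^ 'n \<Rightarrow> real \<Rightarrow> real \<Rightarrow> nat \<times> real"
where
  "cavity_params \<alpha> S \<delta> lam =
     (THE x. case x of (m, \<nu>) \<Rightarrow> 0 \<le> \<nu> \<and> queue_prob \<alpha> S \<delta> m \<nu> 0 = 1 - lam)"

definition cavity_max_queue ::
  "real ^ 'n \<Rightarrow> real ^ 'n ^ 'n \<Rightarrow> real \<Rightarrow> real \<Rightarrow> nat"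
where
  "cavity_max_queue \<alpha> S \<delta> lam =
     (case cavity_params \<alpha> S \<delta> lam of (m, \<nu>) \<Rightarrow> GREATEST q. 0 < queue_prob \<alpha> S \<delta> m \<nu> q)"

end

theory Submission imports Defs "HOL-Real_Asymp.Real_Asymp" begin

text \<open>
  Write \<open>u q\<close>, \<open>v q\<close> for the phase vectors of the states with queue length \<open>q\<close> and estimate \<open>m\<close>,
  respectively \<open>m + 1\<close>. The aligned vectors \<open>w q = u q + v (q + 1)\<close> do not feel the job assignments:
  below the top level they satisfy the balance equations of the chain with \<open>\<nu> = 0\<close>. Hence
  the completion rates \<open>w q \<bullet> \<sigma>\<close> form a geometric sequence of ratio \<open>y\<close>, and eliminating the remaining
  unknowns gives \<open>1 / \<pi>\<^sub>0(m, \<nu>) = 1 + \<delta> + \<kappa>(m, \<nu>)\<close> for \<open>m \<ge> 1\<close>, with \<open>\<kappa>\<close> a quotient of an increasing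
  numerator and a decreasing denominator. So \<open>1 / \<pi>\<^sub>0(m, \<nu>)\<close> increases strictly and continuously in \<open>\<nu>\<close> from
  \<open>1 / \<pi>\<^sub>0(m, 0) = 1 + \<delta> (1 + 1/y + \<dots> + 1/y\<^sup>m\<^sup>-\<^sup>1)\<close> to \<open>1 / \<pi>\<^sub>0(m + 1, 0)\<close>, excluding the latter.
  The intervals tile \<open>[1, \<infinity>)\<close>, and solving for the one containing \<open>1 / (1 - \<lambda>)\<close> gives \<open>\<lfloor>mt\<rfloor>\<close>.
\<close>

subsection \<open>Stationary measures of finite chains\<close>

text \<open>Induction by censoring: a state \<open>a\<close> is removed and the flow through it is rerouted,
  \<open>s \<rightarrow> s'\<close> gaining the rate \<open>r s a * r a s' / R\<close>.\<close>
lemma ex_stationary_measure: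
  fixes r :: "'a \<Rightarrow> 'a \<Rightarrow> real"
  assumes "finite A" "A \<noteq> {}" "\<And>s s'. s \<in> A \<Longrightarrow> s' \<in> A \<Longrightarrow> 0 \<le> r s s'"
  shows "\<exists>p. (\<forall>s\<in>A. 0 \<le> p s) \<and> 0 < sum p A \<and>
    (\<forall>s\<in>A. p s * (\<Sum>s'\<in>A. r s s') = (\<Sum>s'\<in>A. p s' * r s' s))"
  using assms
proof (induction A arbitrary: r rule: finite_ne_induct)
  case (singleton a)
  then show ?case by (intro exI[of _ "\<lambda>_. 1"]) auto
next
  case (insert a B)
  define R where "R = (\<Sum>s\<in>B. r a s)"
  have R_nonneg: "0 \<le> R"
    unfolding R_def using insert.prems by (intro sum_nonneg) auto
  show ?case
  proof (cases "R = 0")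
    \<comment> \<open>No flow leaves \<open>a\<close> for \<open>B\<close>, so the point mass at
      \<open>a\<close> is stationary.\<close>
    case True
    then have zero: "r a s = 0" if "s \<in> B" for s
      using that insert by (auto simp: R_def sum_nonneg_eq_0_iff)
    have "(\<Sum>s\<in>B. if s = a then 1 else 0 :: real) = 0"
      using insert by (intro sum.neutral) auto
    moreover have "(\<Sum>s'\<in>B. (if s' = a then 1 else 0) * r s' s) = 0" for s
      using insert by (intro sum.neutral) auto
    ultimately show ?thesis
      using insert zero
      by (intro exI[of _ "\<lambda>s. if s = a then 1 else 0"]) (auto intro!: sum.neutral)
  next
    case False
    with R_nonneg have R: "0 < R" by simp
    define r' where "r' s s' = r s s' + r s a * r a s' / R" for s s'
    have r'_nonneg: "0 \<le> r' s s'" if "s \<in> B" "s' \<in> B" for s s'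
      unfolding r'_def using insert.prems that R by (intro add_nonneg_nonneg divide_nonneg_pos mult_nonneg_nonneg) auto
    have "\<exists>p. (\<forall>s\<in>B. 0 \<le> p s) \<and> 0 < sum p B \<and>
        (\<forall>s\<in>B. p s * (\<Sum>s'\<in>B. r' s s') = (\<Sum>s'\<in>B. p s' * r' s' s))"
      by (rule insert.IH) (rule r'_nonneg)
    then obtain p where p: "\<forall>s\<in>B. 0 \<le> p s" "0 < sum p B"
      and bal: "\<forall>s\<in>B. p s * (\<Sum>s'\<in>B. r' s s') = (\<Sum>s'\<in>B. p s' * r' s' s)"
      by (elim exE conjE)
    \<comment> \<open>The weight of \<open>a\<close> is forced by its own balance equation: inflow
      from \<open>B\<close> over the total outflow \<open>R\<close>.\<close>
    define x where "x = (\<Sum>s\<in>B. p s * r s a) / R"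
    define p' where "p' = p(a := x)"
    have p': "p' a = x" "\<And>s. s \<in> B \<Longrightarrow> p' s = p s"
      using insert.hyps by (auto simp: p'_def)
    have sum_p': "(\<Sum>s\<in>B. p' s * f s) = (\<Sum>s\<in>B. p s * f s)" for f
      by (intro sum.cong) (auto simp: p')
    have x: "0 \<le> x"
      unfolding x_def using R p insert.prems by (intro divide_nonneg_pos sum_nonneg mult_nonneg_nonneg) auto
    have "p' a * (\<Sum>s'\<in>insert a B. r a s') = (\<Sum>s'\<in>insert a B. p' s' * r s' a)"
      using insert.hyps R by (simp add: p' sum_p') (simp add: x_def R_def field_simps)
    moreover have "p' s * (\<Sum>s'\<in>insert a B. r s s') = (\<Sum>s'\<in>insert a B. p' s' * r s' s)"
      if s: "s \<in> B" for s
    proof -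
      \<comment> \<open>The shares \<open>r a s' / R\<close> sum to 1, so rerouting restores exactly
        the lost rate \<open>r s a\<close>.\<close>
      have "(\<Sum>s'\<in>B. r' s s') = (\<Sum>s'\<in>B. r s s') + r s a"
        using R by (simp add: r'_def sum.distrib R_def flip: sum_divide_distrib sum_distrib_left)
      moreover have "(\<Sum>s'\<in>B. p s' * r' s' s) = (\<Sum>s'\<in>B. p s' * r s' s) + x * r a s"
        by (simp add: r'_def x_def sum.distrib distrib_left sum_distrib_left sum_divide_distrib mult_ac)
      ultimately show ?thesis
        using bspec[OF bal s] insert.hyps s by (simp add: p' sum_p' add_ac)
    qed
    moreover have "0 < sum p' (insert a B)"
      using insert.hyps p x sum_p'[of "\<lambda>_. 1"] by (simp add: p')
    ultimately show ?thesis
      using p x by (intro exI[of _ p']) (auto simp: p')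
  qed
qed

subsection \<open>Resolvents of a phase-type subgenerator\<close>

lemma mat_mult_vec: "mat t *v x = t *\<^sub>R (x :: real ^ 'n)"
  by (simp add: vec_eq_iff matrix_vector_mult_def mat_def if_distrib if_distribR cong: if_cong)

lemma vec_mult_mat: "x v* mat t = t *\<^sub>R (x :: real ^ 'n)"
  by (metis mat_mult_vec transpose_mat transpose_matrix_vector)

lemma inner_one_vec: "x \<bullet> (1 :: real ^ 'n) = (\<Sum>i\<in>UNIV. x $ i)"
  by (simp add: inner_vec_def)

lemma inner_vec_nonneg:
  fixes x y :: "real ^ 'n"
  assumes "\<And>i. 0 \<le> x $ i" "\<And>i. 0 \<le> y $ i"
  shows "0 \<le> x \<bullet> y"
  using assms by (simp add: inner_vec_def sum_nonneg)

locale phase_type_law =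
  fixes \<alpha> :: "real ^ 'n" and S :: "real ^ 'n ^ 'n"
  assumes phase_type: "phase_type \<alpha> S"
begin

abbreviation \<sigma> :: "real ^ 'n" where "\<sigma> \<equiv> exit_rates S"

text \<open>The entry \<open>h t $ i\<close> is the Laplace transform at \<open>t\<close> of the residual service time in phase \<open>i\<close>;
  in particular \<open>\<alpha> \<bullet> h \<delta>\<close> is the \<open>y\<close> of the theorem.\<close>

definition R :: "real \<Rightarrow> real ^ 'n ^ 'n" where "R t = matrix_inv (mat t - S)"

definition h :: "real \<Rightarrow> real ^ 'n" where "h t = R t *v \<sigma>"

lemma alpha_nonneg: "0 \<le> \<alpha> $ i" and sum_alpha: "(\<Sum>i\<in>UNIV. \<alpha> $ i) = 1"
  and S_off_diagonal: "i \<noteq> j \<Longrightarrow> 0 \<le> S $ i $ j"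
  and S_row_sum: "(\<Sum>j\<in>UNIV. S $ i $ j) \<le> 0"
  and invertible_S: "invertible S"
  using phase_type by (auto simp: phase_type_def subgenerator_def)

lemma inner_alpha_one: "\<alpha> \<bullet> 1 = 1"
  by (simp add: inner_one_vec sum_alpha)

lemma exit_rates_nth: "\<sigma> $ i = - (\<Sum>j\<in>UNIV. S $ i $ j)"
  by (simp add: exit_rates_def matrix_vector_mult_def sum_negf)

lemma exit_rates_nonneg: "0 \<le> \<sigma> $ i"
  using S_row_sum by (simp add: exit_rates_nth)

lemma resolvent_mult: "(mat t - S) *v x = t *\<^sub>R x - S *v x"
  by (simp add: matrix_vector_mult_diff_rdistrib mat_mult_vec)

lemma mult_resolvent: "x v* (mat t - S) = t *\<^sub>R x - x v* S"
  by (simp add: vector_matrix_mult_diff_rdistrib vec_mult_mat)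

lemma S_mult_one: "S *v 1 = - \<sigma>"
  by (simp add: vec_eq_iff exit_rates_nth matrix_vector_mult_def)

text \<open>Minimum principle: at an index \<open>k\<close> where \<open>x\<close> is least, the
  nonnegative off-diagonal entries leave \<open>0 \<le> (t + \<sigma> $ k) * x $ k\<close>.
  Positivity of the factor comes from \<open>t\<close>, since \<open>\<sigma> $ k\<close> may
  vanish.\<close>

lemma nonneg_of_resolvent_pos:
  assumes t: "0 < t" and x: "\<And>i. 0 \<le> ((mat t - S) *v x) $ i"
  shows "0 \<le> x $ i"
proof -
  obtain k where k: "\<And>j. x $ k \<le> x $ j"
    using ex_is_arg_min_if_finite[of UNIV "($) x"] by (auto simp: is_arg_min_linorder)
  have *: "(\<Sum>j\<in>UNIV. S $ k $ j * x $ k) \<le> (\<Sum>j\<in>UNIV. S $ k $ j * x $ j)"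
    using k S_off_diagonal by (intro sum_mono) (metis mult_left_mono order_refl)
  have "0 \<le> t * x $ k - (\<Sum>j\<in>UNIV. S $ k $ j * x $ j)"
    using x[of k] by (simp add: resolvent_mult) (simp add: matrix_vector_mult_def)
  with * have "0 \<le> (t + \<sigma> $ k) * x $ k"
    by (simp add: exit_rates_nth sum_distrib_right[symmetric] left_diff_distrib)
  then have "0 \<le> x $ k"
    using t exit_rates_nonneg[of k] by (simp add: zero_le_mult_iff)
  then show ?thesis using k order_trans by blast
qed

text \<open>For positive \<open>t\<close> the minimum principle applies to a kernel vector and to
  its negative; \<open>t = 0\<close> is the invertibility of \<open>S\<close>.\<close>

lemma invertible_resolvent:
  assumes "0 \<le> t"
  shows "invertible (mat t - S)"
proof -
  have "x = 0" if x: "(mat t - S) *v x = 0" for x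
  proof (cases "t = 0")
    case True
    with x have "S *v x = 0" unfolding resolvent_mult by simp
    then show ?thesis using invertible_S
      by (metis invertible_left_inverse matrix_left_invertible_ker)
  next
    case False
    then have t: "0 < t" using assms by simp
    have "(mat t - S) *v (- x) = 0"
      using x matrix_vector_mult_diff_distrib[of "mat t - S" 0 x] by simp
    then have "0 \<le> (- x) $ i" for i
      using nonneg_of_resolvent_pos[OF t, of "- x" i] by simp
    moreover have "0 \<le> x $ i" for i
      using x nonneg_of_resolvent_pos[OF t, of x i] by simp
    ultimately show ?thesis by (simp add: vec_eq_iff antisym)
  qed
  then show ?thesis
    by (simp add: invertible_left_inverse matrix_left_invertible_ker)
qed

lemma
  assumes "0 \<le> t"
  shows resolvent_R: "(mat t - S) ** R t = mat 1"
    and R_resolvent: "R t ** (mat t - S) = mat 1"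
  using someI_ex[OF invertible_resolvent[OF assms, unfolded invertible_def]]
  by (auto simp: R_def matrix_inv_def)

lemma resolvent_R_mult: "0 \<le> t \<Longrightarrow> (mat t - S) *v (R t *v x) = x"
  by (simp add: matrix_vector_mul_assoc resolvent_R)

lemma R_resolvent_mult: "0 \<le> t \<Longrightarrow> R t *v ((mat t - S) *v x) = x"
  by (simp add: matrix_vector_mul_assoc R_resolvent)

lemma mult_R_resolvent: "0 \<le> t \<Longrightarrow> (x v* R t) v* (mat t - S) = x"
  by (simp add: vector_matrix_mul_assoc R_resolvent)

lemma mult_resolvent_eq_iff: "0 \<le> t \<Longrightarrow> x v* (mat t - S) = b \<longleftrightarrow> x = b v* R t"
  by (metis vector_matrix_mul_assoc R_resolvent resolvent_R vector_matrix_mul_rid)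

text \<open>The resolvent identity, the source of monotonicity in \<open>t\<close>, of the Lipschitz
  bound and of the passage to \<open>t = 0\<close>.\<close>

lemma R_diff:
  assumes "0 \<le> t" "0 \<le> u"
  shows "R t *v x - R u *v x = (u - t) *\<^sub>R (R t *v (R u *v x))"
proof -
  have "(mat t - S) *v (R u *v x) = x + (t - u) *\<^sub>R (R u *v x)"
    using resolvent_R_mult[OF assms(2), of x] unfolding resolvent_mult
    by (simp add: scaleR_left_diff_distrib eq_diff_eq diff_eq_eq)
  then have "R u *v x = R t *v x + (t - u) *\<^sub>R (R t *v (R u *v x))"
    by (metis R_resolvent_mult[OF assms(1)] matrix_vector_right_distrib matrix_vector_mult_scaleR)
  then show ?thesis by (simp add: algebra_simps)
qed

text \<open>The minimum principle requires \<open>0 < t\<close>; the case \<open>t = 0\<close> is a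
  limit from the right, with an error of order \<open>u\<close> by the resolvent identity.\<close>

lemma R_mult_nonneg:
  assumes t: "0 \<le> t" and x: "\<And>i. 0 \<le> x $ i"
  shows "0 \<le> (R t *v x) $ i"
proof (cases "t = 0")
  case False
  then show ?thesis
    using t x nonneg_of_resolvent_pos[of t "R t *v x" i] by (simp add: resolvent_R_mult)
next
  case True
  define w where "w u = R u *v x" for u
  have w_nonneg: "0 \<le> w u $ j" if "0 < u" for u j
    using that x nonneg_of_resolvent_pos[of u "R u *v x" j] by (simp add: w_def resolvent_R_mult)
  obtain B where B: "0 < B" "\<And>v. norm (R 0 *v v) \<le> norm v * B"
    using bounded_linear.pos_bounded[OF matrix_vector_mul_bounded_linear] by blast
  have diff: "norm (w 0 - w u) \<le> u * (norm (w u) * B)" if "0 < u" for u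
    using R_diff[of 0 u x] B(2)[of "w u"] that by (simp add: w_def mult_left_mono)
  \<comment> \<open>The bound on \<open>u\<close> lets the error be absorbed, so that
    \<open>norm (w u)\<close> is at most \<open>2 * norm (w 0)\<close>.\<close>
  have lower: "- (u * (2 * norm (w 0) * B)) \<le> w 0 $ i" if u: "0 < u" "u \<le> 1 / (2 * B)" for u
  proof -
    have "u * (norm (w u) * B) \<le> norm (w u) / 2"
      using u B mult_left_mono[of "u * B" "1 / 2" "norm (w u)"] by (simp add: field_simps)
    moreover have "norm (w u) \<le> norm (w 0) + norm (w 0 - w u)"
      by (metis add.commute norm_minus_commute norm_triangle_sub)
    ultimately have "norm (w u) \<le> 2 * norm (w 0)"
      using diff[OF u(1)] by simp
    then have "norm (w 0 - w u) \<le> u * (2 * norm (w 0) * B)"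
      using diff[OF u(1)] u(1) B(1) by (smt (verit) mult_left_mono mult_right_mono)
    then show ?thesis
      using component_le_norm_cart[of "w 0 - w u" i] w_nonneg[OF u(1), of i] by simp
  qed
  have "((\<lambda>u. - (u * (2 * norm (w 0) * B))) \<longlongrightarrow> 0) (at_right 0)"
    by (rule tendsto_eq_intros | simp)+
  moreover have "\<forall>\<^sub>F u in at_right 0. - (u * (2 * norm (w 0) * B)) \<le> w 0 $ i"
    using eventually_at_right_less[of 0] eventually_at_right_real[of 0 "1 / (2 * B)"] B(1)
    by (auto elim!: eventually_mono intro: lower)
  ultimately have "0 \<le> w 0 $ i"
    by (intro tendsto_upperbound[where F = "at_right 0"]) auto
  with True show ?thesis by (simp add: w_def)
qed

lemma mult_R_nonneg:
  assumes t: "0 \<le> t" and x: "\<And>i. 0 \<le> x $ i"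
  shows "0 \<le> (x v* R t) $ j"
proof -
  have "0 \<le> (R t *v axis j 1) $ i" for i
    using t by (intro R_mult_nonneg) (auto simp: axis_def)
  then have "0 \<le> x \<bullet> (R t *v axis j 1)"
    using x by (intro inner_vec_nonneg)
  then show ?thesis
    by (simp add: dot_lmul_matrix[symmetric] inner_axis)
qed

lemma resolvent_h: "0 \<le> t \<Longrightarrow> (mat t - S) *v h t = \<sigma>"
  by (simp add: h_def resolvent_R_mult)

lemma h_0: "h 0 = 1"
  using R_resolvent_mult[of 0 1] unfolding resolvent_mult by (simp add: h_def S_mult_one)

lemma h_nonneg: "0 \<le> t \<Longrightarrow> 0 \<le> h t $ i"
  unfolding h_def by (intro R_mult_nonneg exit_rates_nonneg)

lemma h_diff: "0 \<le> t \<Longrightarrow> 0 \<le> u \<Longrightarrow> h t - h u = (u - t) *\<^sub>R (R t *v h u)"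
  unfolding h_def by (rule R_diff)

lemma h_antimono:
  assumes "0 \<le> t" "t \<le> u"
  shows "h u $ i \<le> h t $ i"
proof -
  have "0 \<le> (u - t) * (R t *v h u) $ i"
    using assms by (intro mult_nonneg_nonneg R_mult_nonneg h_nonneg) auto
  then have "0 \<le> (h t - h u) $ i"
    using assms by (subst h_diff) auto
  then show ?thesis by simp
qed

lemma h_le_one: "0 \<le> t \<Longrightarrow> h t $ i \<le> 1"
  using h_antimono[of 0 t i] by (simp add: h_0)

lemma R_mult_mono:
  assumes "0 \<le> t" "\<And>i. x $ i \<le> x' $ i"
  shows "(R t *v x) $ i \<le> (R t *v x') $ i"
  using R_mult_nonneg[of t "x' - x" i] assms by (simp add: matrix_vector_mult_diff_distrib)

lemma R_one_antimono:
  assumes "0 \<le> t"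
  shows "(R t *v 1) $ i \<le> (R 0 *v 1) $ i"
proof -
  have "0 \<le> t * (R 0 *v (R t *v 1)) $ i"
    using assms by (intro mult_nonneg_nonneg R_mult_nonneg) auto
  then show ?thesis
    using R_diff[of 0 t 1] assms by (simp add: vec_eq_iff) (metis diff_ge_0_iff_ge)
qed

text \<open>The constant is the mean residual service time in phase \<open>i\<close>. It does not
  depend on \<open>t\<close> or \<open>u\<close>, so continuity includes the endpoint 0.\<close>

lemma h_lipschitz:
  assumes "0 \<le> t" "t \<le> u"
  shows "h t $ i - h u $ i \<le> (u - t) * (R 0 *v 1) $ i"
proof -
  have "h t $ i - h u $ i = (u - t) * (R t *v h u) $ i"
    using h_diff[of t u] assms by (simp add: vec_eq_iff)
  also have "\<dots> \<le> (u - t) * (R 0 *v 1) $ i"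
    using assms order_trans[OF R_mult_mono R_one_antimono, of t "h u" i] h_le_one[of u]
    by (intro mult_left_mono) auto
  finally show ?thesis .
qed

text \<open>The phases where \<open>h t\<close> vanishes form a closed class without exit. Its indicator
  is a subsolution for \<open>-S\<close>, hence nonpositive, so the class is empty.\<close>
lemma h_pos:
  assumes t: "0 \<le> t"
  shows "0 < h t $ i"
proof (rule ccontr)
  assume "\<not> 0 < h t $ i"
  then have i: "h t $ i = 0" using h_nonneg[OF t, of i] by simp
  define f :: "real ^ 'n" where "f = (\<chi> k. if h t $ k = 0 then 1 else 0)"
  have "0 \<le> (S *v f) $ k" for k
  proof (cases "h t $ k = 0")
    case True
    have "((mat t - S) *v h t) $ k = \<sigma> $ k"
      by (simp only: resolvent_h[OF t])
    then have eq: "\<sigma> $ k + (\<Sum>j\<in>UNIV. S $ k $ j * h t $ j) = 0"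
      unfolding resolvent_mult using True by (simp add: matrix_vector_mult_def)
    have nonneg: "0 \<le> S $ k $ j * h t $ j" for j
      using S_off_diagonal[of k j] h_nonneg[OF t, of j] True by (cases "j = k") auto
    then have "\<sigma> $ k = 0" "(\<Sum>j\<in>UNIV. S $ k $ j * h t $ j) = 0"
      using eq exit_rates_nonneg[of k] sum_nonneg[of UNIV "\<lambda>j. S $ k $ j * h t $ j"]
      by (auto simp: add_nonneg_eq_0_iff)
    then have "S $ k $ j * h t $ j = 0" for j
      using nonneg by (simp add: sum_nonneg_eq_0_iff)
    then have "(\<Sum>j\<in>UNIV. S $ k $ j * f $ j) = (\<Sum>j\<in>UNIV. S $ k $ j)"
      by (intro sum.cong) (auto simp: f_def)
    with \<open>\<sigma> $ k = 0\<close> show ?thesis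
      by (simp add: matrix_vector_mult_def exit_rates_nth)
  next
    case False
    then have "0 \<le> S $ k $ j * f $ j" for j
      using S_off_diagonal[of k j] by (cases "j = k") (auto simp: f_def)
    then show ?thesis by (simp add: matrix_vector_mult_def sum_nonneg)
  qed
  then have "0 \<le> (R 0 *v (S *v f)) $ i"
    by (intro R_mult_nonneg) auto
  moreover have "R 0 *v (S *v f) = - f"
    using R_resolvent_mult[of 0 f]
    by (metis diff_0 diff_self matrix_vector_mult_diff_distrib minus_minus order_refl resolvent_mult scaleR_zero_left)
  ultimately show False using i by (simp add: f_def)
qed

text \<open>Duality: \<open>\<sigma>\<close> equals \<open>(mat t - S) *v h t\<close>, so the
  completion rate of a solution \<open>x\<close> is read off its source \<open>b\<close>. This turns
  vector balance equations into scalar ones.\<close>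

lemma inner_exit_rates:
  assumes "0 \<le> t" "x v* (mat t - S) = b"
  shows "x \<bullet> \<sigma> = b \<bullet> h t"
  using assms by (metis dot_lmul_matrix resolvent_h)

context
  fixes a :: "real ^ 'n"
  assumes a: "\<And>i. 0 \<le> a $ i"
begin

lemma inner_h_nonneg: "0 \<le> t \<Longrightarrow> 0 \<le> a \<bullet> h t"
  using a by (intro inner_vec_nonneg h_nonneg)

lemma inner_h_pos:
  assumes "a \<noteq> 0" "0 \<le> t"
  shows "0 < a \<bullet> h t"
proof -
  obtain i where "a $ i \<noteq> 0" using assms(1) by (auto simp: vec_eq_iff)
  then have "0 < a $ i * h t $ i" using a[of i] h_pos[OF assms(2), of i] by simp
  then show ?thesis
    unfolding inner_vec_def using a h_nonneg[OF assms(2)]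
    by (intro sum_pos2[where i = i]) auto
qed

lemma inner_h_antimono:
  assumes "0 \<le> t" "t \<le> u"
  shows "a \<bullet> h u \<le> a \<bullet> h t"
proof -
  have "0 \<le> a \<bullet> (h t - h u)"
    using a h_antimono[OF assms] by (intro inner_vec_nonneg) auto
  then show ?thesis by (simp add: inner_diff_right)
qed

lemma continuous_on_inner_h: "continuous_on {0..} (\<lambda>t. a \<bullet> h t)"
proof -
  define C where "C = a \<bullet> (R 0 *v 1)"
  have C: "0 \<le> C"
    unfolding C_def using a by (intro inner_vec_nonneg R_mult_nonneg) auto
  have le: "\<bar>a \<bullet> h t - a \<bullet> h u\<bar> \<le> C * \<bar>t - u\<bar>" if "0 \<le> t" "t \<le> u" for t u
  proof -
    have "0 \<le> a \<bullet> ((u - t) *\<^sub>R (R 0 *v 1) - (h t - h u))"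
      using a h_lipschitz[OF that] by (intro inner_vec_nonneg) auto
    then have "a \<bullet> h t - a \<bullet> h u \<le> C * (u - t)"
      by (simp add: inner_diff_right C_def mult.commute)
    then show ?thesis using inner_h_antimono[OF that] that by simp
  qed
  have "C-lipschitz_on {0..} (\<lambda>t. a \<bullet> h t)"
  proof (rule lipschitz_onI)
    fix t u :: real assume "t \<in> {0..}" "u \<in> {0..}"
    then show "dist (a \<bullet> h t) (a \<bullet> h u) \<le> C * dist t u"
      using le[of t u] le[of u t] linear[of t u] by (auto simp: dist_real_def abs_minus_commute)
  qed (rule C)
  then show ?thesis by (rule lipschitz_on_continuous_on)
qed

end

end

subsection \<open>Balance equations of the push chain\<close>

lemma sum_push_states:
  fixes f :: "'n::finite state \<Rightarrow> real"
  shows "sum f (push_states m) = f (Idle m) + f (Idle (m + 1))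
    + (\<Sum>q\<in>{1..m}. \<Sum>j\<in>UNIV. f (Busy q m j)) + (\<Sum>q\<in>{1..m + 1}. \<Sum>j\<in>UNIV. f (Busy q (m + 1) j))"
proof -
  define B where "B e = (\<lambda>(q, j :: 'n). Busy q e j) ` ({1..e} \<times> UNIV)" for e
  have "push_states m = {Idle m, Idle (m + 1)} \<union> (B m \<union> B (m + 1))"
    by (auto simp: push_states_def B_def)
  moreover have "finite (B e)" for e by (simp add: B_def)
  moreover have "sum f (B e) = (\<Sum>q\<in>{1..e}. \<Sum>j\<in>UNIV. f (Busy q e j))" for e
    unfolding B_def by (subst sum.reindex) (auto simp: inj_on_def sum.cartesian_product intro!: sum.cong)
  moreover have "B m \<inter> B (m + 1) = {}" "{Idle m, Idle (m + 1)} \<inter> (B m \<union> B (m + 1)) = {}"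
    by (auto simp: B_def)
  ultimately show ?thesis
    by (simp add: sum.union_disjoint)
qed

lemma finite_push_states: "finite (push_states m :: 'n::finite state set)"
proof -
  have "push_states m \<subseteq> Idle ` {m, m + 1} \<union>
      (\<lambda>(q, e, j :: 'n). Busy q e j) ` ({..m + 1} \<times> {m, m + 1} \<times> UNIV)"
    by (auto simp: push_states_def image_iff)
  then show ?thesis by (rule finite_subset) auto
qed

text \<open>\<open>A\<close>, \<open>B\<close>, \<open>C\<close>, \<open>E\<close> stand for the
  phase-independent guards of the four kinds of transition in \<open>push_rate\<close>. Keeping them
  symbolic lets one rewrite serve all blocks.\<close>

lemma sum_phases_inflow:
  fixes x c :: "'n::finite \<Rightarrow> real"
  shows "(\<Sum>i\<in>UNIV. x i * ((if A \<and> j \<noteq> i then S $ i $ j else 0) + (if B then c i * d else 0)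
      + (if C \<and> j = i then \<delta> else 0) + (if E \<and> j = i then \<nu> else 0)))
    = (if A then \<Sum>i\<in>UNIV - {j}. x i * S $ i $ j else 0) + (if B then (\<Sum>i\<in>UNIV. x i * c i) * d else 0)
      + (if C then \<delta> * x j else 0) + (if E then \<nu> * x j else 0)"
proof -
  have "(\<Sum>i\<in>UNIV. if j \<noteq> i then x i * S $ i $ j else 0) = (\<Sum>i\<in>UNIV - {j}. x i * S $ i $ j)"
    by (intro sum.mono_neutral_cong_right) auto
  then have "(\<Sum>i\<in>UNIV. x i * (if A \<and> j \<noteq> i then S $ i $ j else 0))
      = (if A then \<Sum>i\<in>UNIV - {j}. x i * S $ i $ j else 0)"
    by (simp add: if_distrib cong: if_cong)
  moreover have "(\<Sum>i\<in>UNIV. x i * (if B then c i * d else 0)) = (if B then (\<Sum>i\<in>UNIV. x i * c i) * d else 0)"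
    by (simp add: sum_distrib_right mult.assoc)
  moreover have "(\<Sum>i\<in>UNIV. x i * (if C \<and> j = i then d' else 0)) = (if C then d' * x j else 0)" for C d'
    by (simp add: if_distrib cong: if_cong)
  ultimately show ?thesis
    by (simp only: distrib_left sum.distrib)
qed

lemma sum_phases_outflow:
  fixes c :: "'n::finite \<Rightarrow> real"
  shows "(\<Sum>i\<in>UNIV. (if A \<and> i \<noteq> j then S $ j $ i else 0) + (if B then d * c i else 0)
      + (if C \<and> i = j then \<delta> else 0) + (if E \<and> i = j then \<nu> else 0))
    = (if A then \<Sum>i\<in>UNIV - {j}. S $ j $ i else 0) + (if B then d * (\<Sum>i\<in>UNIV. c i) else 0)
      + (if C then \<delta> else 0) + (if E then \<nu> else 0)"
proof -
  have "(\<Sum>i\<in>UNIV. if i \<noteq> j then S $ j $ i else 0) = (\<Sum>i\<in>UNIV - {j}. S $ j $ i)"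
    by (intro sum.mono_neutral_cong_right) auto
  then have "(\<Sum>i\<in>UNIV. if A \<and> i \<noteq> j then S $ j $ i else 0)
      = (if A then \<Sum>i\<in>UNIV - {j}. S $ j $ i else 0)"
    by simp
  moreover have "(\<Sum>i\<in>UNIV. if B then d * c i else 0) = (if B then d * (\<Sum>i\<in>UNIV. c i) else 0)"
    by (simp add: sum_distrib_left)
  moreover have "(\<Sum>i\<in>UNIV. if C \<and> i = j then d' else 0) = (if C then d' else 0)" for C and d' :: real
    by (cases C) simp_all
  ultimately show ?thesis
    by (simp only: sum.distrib)
qed

text \<open>Collapses a guarded sum over queue lengths; \<open>Q\<close> is the part of the guard
  that does not involve \<open>q\<close>.\<close>

lemma sum_if_eq:
  fixes f :: "nat \<Rightarrow> real"
  assumes "\<And>q. 1 \<le> q \<Longrightarrow> q \<le> n \<Longrightarrow> P q \<longleftrightarrow> q = k \<and> Q"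
  shows "(\<Sum>q\<in>{1..n}. if P q then f q else 0) = (if Q \<and> 1 \<le> k \<and> k \<le> n then f k else 0)"
proof -
  have "(\<Sum>q\<in>{1..n}. if P q then f q else 0) = (\<Sum>q\<in>{1..n}. if q = k then if Q then f k else 0 else 0)"
    using assms by (intro sum.cong) auto
  then show ?thesis by auto
qed

context phase_type_law
begin

context
  fixes \<delta> \<nu> :: real and m :: nat
begin

abbreviation "rate \<equiv> push_rate \<alpha> S \<delta> m \<nu>"

text \<open>Self-loops count: for \<open>m = 0\<close> the probe in \<open>Idle 0\<close> stays in
  place, yet contributes \<open>\<delta>\<close>.\<close>

lemma outflow_idle: "(\<Sum>s\<in>push_states m. rate (Idle m) s) = \<delta> + \<nu>"
  "(\<Sum>s\<in>push_states m. rate (Idle (m + 1)) s) = \<delta>"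
proof -
  have *: "(\<Sum>j\<in>UNIV. if A then c * \<alpha> $ j else 0) = (if A then c else 0)" for c A
    by (simp add: sum_alpha flip: sum_distrib_left)
  show "(\<Sum>s\<in>push_states m. rate (Idle m) s) = \<delta> + \<nu>"
    by (cases "m = 0") (simp_all add: sum_push_states sum.distrib * sum_distrib_left[symmetric] sum_alpha)
  show "(\<Sum>s\<in>push_states m. rate (Idle (m + 1)) s) = \<delta>"
    by (cases "m = 0") (simp_all add: sum_push_states sum.distrib * sum_distrib_left[symmetric] sum_alpha)
qed

lemma exit_rates_off_diagonal: "(\<Sum>i\<in>UNIV - {j}. S $ j $ i) + \<sigma> $ j = - S $ j $ j"
  by (simp add: exit_rates_nth sum.remove[of UNIV j])

text \<open>The guard \<open>1 \<le> q - 1\<close> says that a job remains after the completion; for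
  \<open>q = 1\<close> the rate \<open>\<sigma> $ j\<close> leads to an idle state and is absent
  from the block.\<close>

lemma outflow_block:
  assumes "1 \<le> q"
  shows "(\<Sum>q'\<in>{1..e'}. \<Sum>i\<in>UNIV. rate (Busy q e j) (Busy q' e' i)) =
      (if e' = e \<and> 1 \<le> q \<and> q \<le> e' then \<Sum>i\<in>UNIV - {j}. S $ j $ i else 0)
    + (if e' = e \<and> 1 \<le> q - 1 \<and> q - 1 \<le> e' then \<sigma> $ j else 0)
    + (if e' = max q m \<and> 1 \<le> max q m \<and> max q m \<le> e' then \<delta> else 0)
    + (if (e = m \<and> e' = m + 1) \<and> 1 \<le> q + 1 \<and> q + 1 \<le> e' then \<nu> else 0)"
proof -
  have "(\<Sum>q'\<in>{1..e'}. if (2 \<le> q \<and> q' = q - 1) \<and> e' = e then c else 0)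
      = (if e' = e \<and> 1 \<le> q - 1 \<and> q - 1 \<le> e' then c else 0)" for c :: real
    by (intro sum_if_eq) auto
  moreover have "(\<Sum>q'\<in>{1..e'}. if q' = q \<and> e' = e then c else 0)
      = (if e' = e \<and> 1 \<le> q \<and> q \<le> e' then c else 0)" for c :: real
    by (intro sum_if_eq) auto
  moreover have "(\<Sum>q'\<in>{1..e'}. if q' = max q m \<and> e' = max q m then c else 0)
      = (if e' = max q m \<and> 1 \<le> max q m \<and> max q m \<le> e' then c else 0)" for c :: real
    by (intro sum_if_eq) auto
  moreover have "(\<Sum>q'\<in>{1..e'}. if (e = m \<and> q' = q + 1) \<and> e' = m + 1 then c else 0)
      = (if (e = m \<and> e' = m + 1) \<and> 1 \<le> q + 1 \<and> q + 1 \<le> e' then c else 0)" for c :: real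
    by (intro sum_if_eq) auto
  ultimately show ?thesis
    unfolding push_rate.simps conj_assoc[symmetric] sum_phases_outflow
    by (simp only: sum.distrib sum_alpha mult_1_right)
qed

lemma outflow_busy_low:
  assumes "1 \<le> q" "q \<le> m"
  shows "(\<Sum>s\<in>push_states m. rate (Busy q m j) s) = - S $ j $ j + \<delta> + \<nu>"
  using assms exit_rates_off_diagonal[of j]
  unfolding sum_push_states outflow_block[OF assms(1)] by (auto simp: max_def)

lemma outflow_busy_high:
  assumes "1 \<le> q" "q \<le> m + 1"
  shows "(\<Sum>s\<in>push_states m. rate (Busy q (m + 1) j) s) = - S $ j $ j + \<delta>"
  using assms exit_rates_off_diagonal[of j]
  unfolding sum_push_states outflow_block[OF assms(1)] by (auto simp: max_def)

lemma inflow_idle_block: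
  "(\<Sum>q'\<in>{1..e'}. \<Sum>i\<in>UNIV. p (Busy q' e' i) * rate (Busy q' e' i) (Idle e))
    = (if e = e' \<and> 1 \<le> e' then \<Sum>i\<in>UNIV. p (Busy 1 e' i) * \<sigma> $ i else 0)"
proof -
  have "(\<Sum>i\<in>UNIV. p (Busy q' e' i) * rate (Busy q' e' i) (Idle e))
      = (if q' = 1 \<and> e = e' then \<Sum>i\<in>UNIV. p (Busy 1 e' i) * \<sigma> $ i else 0)" for q'
    by auto
  then show ?thesis
    using sum_if_eq[of e' "\<lambda>q'. q' = 1 \<and> e = e'" 1 "e = e'"] by simp
qed

lemma inflow_idle_low:
  "(\<Sum>s\<in>push_states m. p s * rate s (Idle m)) =
    (if m = 0 then \<delta> * (p (Idle 0) + p (Idle 1)) else \<Sum>i\<in>UNIV. p (Busy 1 m i) * \<sigma> $ i)"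
  unfolding sum_push_states inflow_idle_block by (auto simp: algebra_simps)

lemma inflow_idle_high:
  "(\<Sum>s\<in>push_states m. p s * rate s (Idle (m + 1))) = (\<Sum>i\<in>UNIV. p (Busy 1 (m + 1) i) * \<sigma> $ i)"
  unfolding sum_push_states inflow_idle_block by auto

lemma inflow_busy_block:
  assumes "1 \<le> q"
  shows "(\<Sum>q'\<in>{1..e'}. \<Sum>i\<in>UNIV. p (Busy q' e' i) * rate (Busy q' e' i) (Busy q e j)) =
      (if e = e' \<and> 1 \<le> q \<and> q \<le> e' then \<Sum>i\<in>UNIV - {j}. p (Busy q e' i) * S $ i $ j else 0)
    + (if e = e' \<and> 1 \<le> q + 1 \<and> q + 1 \<le> e' then (\<Sum>i\<in>UNIV. p (Busy (q + 1) e' i) * \<sigma> $ i) * \<alpha> $ j else 0)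
    + (\<Sum>q'\<in>{1..e'}. if q = max q' m \<and> e = max q' m then \<delta> * p (Busy q' e' j) else 0)
    + (if (e' = m \<and> e = m + 1) \<and> 1 \<le> q - 1 \<and> q - 1 \<le> e' then \<nu> * p (Busy (q - 1) e' j) else 0)"
proof -
  have "(\<Sum>q'\<in>{1..e'}. if (2 \<le> q' \<and> q = q' - 1) \<and> e = e' then f q' else 0)
      = (if e = e' \<and> 1 \<le> q + 1 \<and> q + 1 \<le> e' then f (q + 1) else 0)" for f :: "nat \<Rightarrow> real"
    using assms by (intro sum_if_eq) auto
  moreover have "(\<Sum>q'\<in>{1..e'}. if q = q' \<and> e = e' then f q' else 0)
      = (if e = e' \<and> 1 \<le> q \<and> q \<le> e' then f q else 0)" for f :: "nat \<Rightarrow> real"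
    by (intro sum_if_eq) auto
  moreover have "(\<Sum>q'\<in>{1..e'}. if (e' = m \<and> q = q' + 1) \<and> e = m + 1 then f q' else 0)
      = (if (e' = m \<and> e = m + 1) \<and> 1 \<le> q - 1 \<and> q - 1 \<le> e' then f (q - 1) else 0)" for f :: "nat \<Rightarrow> real"
    by (intro sum_if_eq) auto
  ultimately show ?thesis
    unfolding push_rate.simps conj_assoc[symmetric] sum_phases_inflow sum.distrib
    by simp
qed

text \<open>Probes from every state of queue length at most \<open>m\<close> land at queue length
  and estimate \<open>m\<close>. The term \<open>k = m\<close> of the first sum is the self-loop
  there.\<close>

lemma inflow_busy_low:
  assumes "1 \<le> q" "q \<le> m"
  shows "(\<Sum>s\<in>push_states m. p s * rate s (Busy q m j)) = (\<Sum>i\<in>UNIV - {j}. p (Busy q m i) * S $ i $ j)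
    + (if q < m then (\<Sum>i\<in>UNIV. p (Busy (q + 1) m i) * \<sigma> $ i) * \<alpha> $ j else 0)
    + (if q = m then \<delta> * ((\<Sum>k\<in>{1..m}. p (Busy k m j)) + (\<Sum>k\<in>{1..m}. p (Busy k (m + 1) j))
         + (p (Idle m) + p (Idle (m + 1))) * \<alpha> $ j) else 0)"
proof -
  have "(\<Sum>q'\<in>{1..m}. if q = max q' m \<and> m = max q' m then \<delta> * p (Busy q' e' j) else 0)
      = (if q = m then \<delta> * (\<Sum>k\<in>{1..m}. p (Busy k e' j)) else 0)" for e'
    by (simp add: max_def sum_distrib_left)
  then show ?thesis
    using assms unfolding sum_push_states inflow_busy_block[OF assms(1)]
    by (auto simp: algebra_simps)
qed

lemma inflow_busy_high:
  assumes "1 \<le> q" "q \<le> m + 1"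
  shows "(\<Sum>s\<in>push_states m. p s * rate s (Busy q (m + 1) j)) = (\<Sum>i\<in>UNIV - {j}. p (Busy q (m + 1) i) * S $ i $ j)
    + (if q \<le> m then (\<Sum>i\<in>UNIV. p (Busy (q + 1) (m + 1) i) * \<sigma> $ i) * \<alpha> $ j else 0)
    + (if q = m + 1 then \<delta> * p (Busy q (m + 1) j) else 0)
    + \<nu> * (if q = 1 then p (Idle m) * \<alpha> $ j else p (Busy (q - 1) m j))"
proof -
  have "(\<Sum>q'\<in>{1..m}. if q = max q' m \<and> m + 1 = max q' m then \<delta> * p (Busy q' e' j) else 0) = 0" for e'
    by (intro sum.neutral) auto
  then show ?thesis
    using assms unfolding sum_push_states inflow_busy_block[OF assms(1)]
    by (auto simp: algebra_simps)
qed

end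
end

section \<open>Weights in the formula for the idle probability\<close>

context phase_type_law
begin

text \<open>For \<open>m \<ge> 1\<close>, the ratio of \<open>u\<^sub>0\<close> to the completion
  rate \<open>U m \<bullet> \<sigma>\<close> in \<open>push_balance\<close>: each of the
  \<open>m - 1\<close> levels below the top costs one factor
  \<open>\<alpha> \<bullet> h (\<delta> + \<nu>)\<close>.\<close>

definition theta :: "real \<Rightarrow> nat \<Rightarrow> real \<Rightarrow> real" where
  "theta \<delta> m \<nu> = (\<alpha> \<bullet> h (\<delta> + \<nu>)) ^ (m - 1) / (\<delta> + \<nu>)"

text \<open>For \<open>m \<ge> 1\<close>, the ratio of \<open>K\<close> to \<open>idle\<close> in
  \<open>push_balance\<close>, solved from \<open>K_idle\<close>.\<close>

definition kappa :: "real \<Rightarrow> nat \<Rightarrow> real \<Rightarrow> real" where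
  "kappa \<delta> m \<nu> = \<delta> * ((\<Sum>k<m. (\<alpha> \<bullet> h \<delta>) ^ k) - \<delta> * theta \<delta> m \<nu> * (\<alpha> \<bullet> h \<nu>))
     / (\<delta>\<^sup>2 * theta \<delta> m \<nu> * ((\<alpha> v* R \<delta>) \<bullet> h \<nu>) + (\<alpha> \<bullet> h \<delta>) ^ m)"

text \<open>\<open>inv_idle \<delta> m \<nu>\<close> is \<open>1 / \<pi>\<^sub>0(m, \<nu>)\<close>; at \<open>\<nu> = 0\<close> it equals \<open>level \<delta> m\<close> below.\<close>
definition inv_idle :: "real \<Rightarrow> nat \<Rightarrow> real \<Rightarrow> real" where
  "inv_idle \<delta> m \<nu> = (if m = 0 then 1 + \<delta> * \<nu> / (\<delta> + \<nu>) else 1 + \<delta> + kappa \<delta> m \<nu>)"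

lemma mult_resolvent_nth:
  "(x v* (mat t - S)) $ j = x $ j * (t - S $ j $ j) - (\<Sum>i\<in>UNIV - {j}. x $ i * S $ i $ j)"
proof -
  have "(x v* S) $ j = (\<Sum>i\<in>UNIV. x $ i * S $ i $ j)"
    by (simp add: vector_matrix_mult_def mult.commute)
  also have "\<dots> = x $ j * S $ j $ j + (\<Sum>i\<in>UNIV - {j}. x $ i * S $ i $ j)"
    by (rule sum.remove) auto
  finally show ?thesis
    unfolding mult_resolvent by (simp add: algebra_simps)
qed

lemma shift_resolvent: "x v* (mat t - S) = x v* (mat u - S) + (t - u) *\<^sub>R x"
  unfolding mult_resolvent by (simp add: algebra_simps)

lemma reset_exit: "0 < \<delta> \<Longrightarrow> (\<alpha> v* R \<delta>) \<bullet> \<sigma> = \<alpha> \<bullet> h \<delta>"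
  by (simp add: inner_exit_rates mult_R_resolvent)

text \<open>\<open>\<alpha> v* R \<delta>\<close> holds the expected times that a fresh job spends
  in each phase before completion or probe, so the left side is the probability that the probe comes
  first.\<close>

lemma reset_one:
  assumes "0 < \<delta>"
  shows "\<delta> * ((\<alpha> v* R \<delta>) \<bullet> 1) = 1 - \<alpha> \<bullet> h \<delta>"
proof -
  have "1 = (\<alpha> v* R \<delta>) \<bullet> ((mat \<delta> - S) *v 1)"
    using assms by (metis dot_lmul_matrix mult_R_resolvent inner_alpha_one less_imp_le)
  then show ?thesis
    unfolding resolvent_mult S_mult_one using reset_exit[OF assms] by (simp add: inner_add_right)
qed

text \<open>\<open>R 0 *v 1\<close> is the vector \<open>w\<close> of mean residual service times,
  whose \<open>\<alpha>\<close>-average is 1, and \<open>mat \<delta> - S\<close> maps it to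
  \<open>\<delta> *\<^sub>R w + 1\<close>.\<close>

lemma reset_mean:
  assumes "0 < \<delta>" "ph_mean \<alpha> S = 1"
  shows "\<delta> * ((\<alpha> v* R \<delta>) \<bullet> (R 0 *v 1)) = 1 - (\<alpha> v* R \<delta>) \<bullet> 1"
proof -
  define w where "w = R 0 *v 1"
  have "1 = \<alpha> \<bullet> w"
    using assms(2) by (simp add: w_def ph_mean_def R_def dot_lmul_matrix)
  also have "\<dots> = (\<alpha> v* R \<delta>) \<bullet> ((mat \<delta> - S) *v w)"
    using assms(1) by (metis dot_lmul_matrix mult_R_resolvent less_imp_le)
  also have "(mat \<delta> - S) *v w = \<delta> *\<^sub>R w + 1"
    using resolvent_R_mult[of 0 1] unfolding resolvent_mult w_def by simp
  finally show ?thesis by (simp add: inner_add_right w_def)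
qed

end

text \<open>Here \<open>p\<close> may be signed: applied to the difference of two stationary distributions, the results of
  this locale give uniqueness.\<close>
locale push_balance = phase_type_law +
  fixes \<delta> \<nu> :: real and m :: nat and p :: "'a state \<Rightarrow> real"
  assumes delta_pos: "0 < \<delta>" and nu_nonneg: "0 \<le> \<nu>" and mean: "ph_mean \<alpha> S = 1"
    and balance: "\<And>s. s \<in> push_states m \<Longrightarrow> p s * (\<Sum>s'\<in>push_states m. push_rate \<alpha> S \<delta> m \<nu> s s')
          = (\<Sum>s'\<in>push_states m. p s' * push_rate \<alpha> S \<delta> m \<nu> s' s)"
begin

definition U :: "nat \<Rightarrow> real ^ 'a" where "U q = (\<chi> j. p (Busy q m j))"
definition V :: "nat \<Rightarrow> real ^ 'a" where "V q = (\<chi> j. p (Busy q (m + 1) j))"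
abbreviation "u\<^sub>0 \<equiv> p (Idle m)"
abbreviation "v\<^sub>0 \<equiv> p (Idle (m + 1))"
abbreviation "idle \<equiv> u\<^sub>0 + v\<^sub>0"
abbreviation "mass \<equiv> sum p (push_states m)"

lemma inner_exit_U: "U q \<bullet> \<sigma> = (\<Sum>i\<in>UNIV. p (Busy q m i) * \<sigma> $ i)"
  and inner_exit_V: "V q \<bullet> \<sigma> = (\<Sum>i\<in>UNIV. p (Busy q (m + 1) i) * \<sigma> $ i)"
  by (simp_all add: U_def V_def inner_vec_def)

lemma busy_mem: "1 \<le> q \<Longrightarrow> q \<le> m \<Longrightarrow> Busy q m j \<in> push_states m"
  "1 \<le> q \<Longrightarrow> q \<le> m + 1 \<Longrightarrow> Busy q (m + 1) j \<in> push_states m"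
  "Idle m \<in> push_states m" "Idle (m + 1) \<in> push_states m"
  by (auto simp: push_states_def)

lemma balance_u0: "1 \<le> m \<Longrightarrow> (\<delta> + \<nu>) * u\<^sub>0 = U 1 \<bullet> \<sigma>"
  and balance_u0': "m = 0 \<Longrightarrow> \<nu> * u\<^sub>0 = \<delta> * v\<^sub>0"
  using balance[OF busy_mem(3)] unfolding outflow_idle inflow_idle_low inner_exit_U
  by (auto simp: algebra_simps)

lemma balance_v0: "\<delta> * v\<^sub>0 = V 1 \<bullet> \<sigma>"
  using balance[OF busy_mem(4)] unfolding outflow_idle inflow_idle_high inner_exit_V
  by (auto simp: algebra_simps)

lemma balance_U:
  assumes "1 \<le> q" "q < m"
  shows "U q v* (mat (\<delta> + \<nu>) - S) = (U (q + 1) \<bullet> \<sigma>) *\<^sub>R \<alpha>"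
proof -
  have "(U q v* (mat (\<delta> + \<nu>) - S)) $ j = ((U (q + 1) \<bullet> \<sigma>) *\<^sub>R \<alpha>) $ j" for j
    using balance[OF busy_mem(1)[of q j]] assms
    unfolding mult_resolvent_nth inner_exit_U
    by (simp add: outflow_busy_low inflow_busy_low U_def algebra_simps)
  then show ?thesis by (simp add: vec_eq_iff)
qed

text \<open>The probe is a self-loop here and cancels. Hence the parameter is \<open>\<nu>\<close>
  instead of \<open>\<delta> + \<nu>\<close>, and the sum of the \<open>U q\<close> stops below
  \<open>m\<close>.\<close>

lemma balance_U_top:
  assumes "1 \<le> m"
  shows "U m v* (mat \<nu> - S) = \<delta> *\<^sub>R ((\<Sum>q\<in>{1..<m}. U q) + (\<Sum>q\<in>{1..m}. V q) + idle *\<^sub>R \<alpha>)"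
proof -
  have "(\<Sum>k\<in>{1..m}. p (Busy k m j)) = p (Busy m m j) + (\<Sum>k\<in>{1..<m}. p (Busy k m j))" for j
    using assms by (subst sum.last_plus) (auto simp: atLeastLessThanSuc_atLeastAtMost[symmetric])
  then have "(U m v* (mat \<nu> - S)) $ j = (\<delta> *\<^sub>R ((\<Sum>q\<in>{1..<m}. U q) + (\<Sum>q\<in>{1..m}. V q) + idle *\<^sub>R \<alpha>)) $ j" for j
    using balance[OF busy_mem(1)[of m j]] assms
    unfolding mult_resolvent_nth
    by (simp add: outflow_busy_low inflow_busy_low U_def V_def algebra_simps)
  then show ?thesis by (simp add: vec_eq_iff)
qed

lemma balance_V:
  assumes "1 \<le> q" "q \<le> m"
  shows "V q v* (mat \<delta> - S) = (V (q + 1) \<bullet> \<sigma>) *\<^sub>R \<alpha> + \<nu> *\<^sub>R (if q = 1 then u\<^sub>0 *\<^sub>R \<alpha> else U (q - 1))"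
proof -
  have "(V q v* (mat \<delta> - S)) $ j
      = ((V (q + 1) \<bullet> \<sigma>) *\<^sub>R \<alpha> + \<nu> *\<^sub>R (if q = 1 then u\<^sub>0 *\<^sub>R \<alpha> else U (q - 1))) $ j" for j
    using balance[OF busy_mem(2)[of q j]] assms
    unfolding outflow_busy_high[OF assms(1) trans_le_add1[OF assms(2)]]
      inflow_busy_high[OF assms(1) trans_le_add1[OF assms(2)]] mult_resolvent_nth inner_exit_V
    by (simp add: U_def V_def algebra_simps)
  then show ?thesis by (simp add: vec_eq_iff)
qed

text \<open>At the top of estimate \<open>m + 1\<close> probes are self-loops and no job is
  assigned, hence the parameter 0.\<close>

lemma balance_V_top: "V (m + 1) v* (mat 0 - S) = \<nu> *\<^sub>R (if m = 0 then u\<^sub>0 *\<^sub>R \<alpha> else U m)"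
proof -
  have "(V (m + 1) v* (mat 0 - S)) $ j = (\<nu> *\<^sub>R (if m = 0 then u\<^sub>0 *\<^sub>R \<alpha> else U m)) $ j" for j
    using balance[OF busy_mem(2)[of "m + 1" j]]
    unfolding outflow_busy_high[OF le_add2 order_refl] inflow_busy_high[OF le_add2 order_refl] mult_resolvent_nth U_def V_def
    by (cases "m = 0") (simp_all add: algebra_simps neg_eq_iff_add_eq_0)
  then show ?thesis by (simp add: vec_eq_iff)
qed

lemma mass_eq: "mass = idle + (\<Sum>q\<in>{1..m}. U q \<bullet> 1) + (\<Sum>q\<in>{1..m + 1}. V q \<bullet> 1)"
  unfolding sum_push_states by (simp add: U_def V_def inner_one_vec)


lemma mean_R: "\<alpha> \<bullet> (R 0 *v 1) = 1"
  using mean by (simp add: ph_mean_def R_def dot_lmul_matrix)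

lemma inner_one_eq:
  assumes "x v* (mat 0 - S) = b"
  shows "x \<bullet> 1 = b \<bullet> (R 0 *v 1)"
  by (metis assms dot_lmul_matrix order_refl resolvent_R_mult)

abbreviation "a \<equiv> \<alpha> v* R \<delta>"
abbreviation "y \<equiv> \<alpha> \<bullet> h \<delta>"
abbreviation "z \<equiv> \<alpha> \<bullet> h (\<delta> + \<nu>)"
abbreviation "Y \<equiv> (\<Sum>k<m. y ^ k)"

section \<open>Aligned vectors and elimination of the unknowns\<close>

definition W :: "nat \<Rightarrow> real ^ 'a" where "W q = U q + V (q + 1)"
definition c :: "nat \<Rightarrow> real" where "c q = W q \<bullet> \<sigma>"
text \<open>The coefficient of \<open>a\<close> in the sum of all busy vectors outside
  \<open>W m\<close>, see \<open>sum_W\<close>.\<close>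

definition K :: real where "K = c m * Y - \<delta> * u\<^sub>0"

text \<open>The assignment flow \<open>\<nu> *\<^sub>R U q\<close> leaves \<open>U q\<close> and
  enters \<open>V (q + 1)\<close>, so it cancels in the sum.\<close>

lemma W_eq:
  assumes "1 \<le> q" "q < m"
  shows "W q = c (q + 1) *\<^sub>R a"
proof -
  have "U q v* (mat \<delta> - S) = (U (q + 1) \<bullet> \<sigma>) *\<^sub>R \<alpha> - \<nu> *\<^sub>R U q"
    using balance_U[OF assms] shift_resolvent[of "U q" \<delta> "\<delta> + \<nu>"] by simp
  moreover have "V (q + 1) v* (mat \<delta> - S) = (V (q + 2) \<bullet> \<sigma>) *\<^sub>R \<alpha> + \<nu> *\<^sub>R U q"
    using balance_V[of "q + 1"] assms by simp
  ultimately have "W q v* (mat \<delta> - S) = c (q + 1) *\<^sub>R \<alpha>"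
    by (simp add: W_def c_def vector_matrix_left_distrib inner_add_left scaleR_add_left)
  then show ?thesis
    using delta_pos by (simp add: mult_resolvent_eq_iff scaleR_vector_matrix_assoc)
qed

lemma c_geometric: "k < m \<Longrightarrow> c (m - k) = y ^ k * c m"
proof (induction k)
  case (Suc k)
  then have "c (m - Suc k) = c (m - k) * (a \<bullet> \<sigma>)"
    using W_eq[of "m - Suc k"] by (simp add: c_def[of "m - Suc k"] Suc_diff_Suc)
  with Suc delta_pos show ?case by (simp add: reset_exit)
qed simp

text \<open>For \<open>U\<close> alone assignments are losses as well, so the ratio is
  \<open>z\<close> instead of \<open>y\<close>.\<close>

lemma exit_U_geometric: "k < m \<Longrightarrow> U (m - k) \<bullet> \<sigma> = z ^ k * (U m \<bullet> \<sigma>)"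
proof (induction k)
  case (Suc k)
  have "U (m - Suc k) v* (mat (\<delta> + \<nu>) - S) = (U (m - k) \<bullet> \<sigma>) *\<^sub>R \<alpha>"
    using balance_U[of "m - Suc k"] Suc.prems by (simp add: Suc_diff_Suc)
  then have "U (m - Suc k) \<bullet> \<sigma> = (U (m - k) \<bullet> \<sigma>) * z"
    using inner_exit_rates[of "\<delta> + \<nu>"] delta_pos nu_nonneg by simp
  with Suc show ?case by simp
qed simp

context
  assumes m: "1 \<le> m"
begin

text \<open>Since \<open>U 1 \<bullet> \<sigma>\<close> is
  \<open>(\<delta> + \<nu>) * u\<^sub>0\<close>, the source of \<open>V 1\<close> can be written
  with \<open>c 1\<close>, and \<open>\<nu>\<close> drops out.\<close>

lemma V_1: "V 1 = (c 1 - \<delta> * u\<^sub>0) *\<^sub>R a"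
proof -
  have "c 1 - \<delta> * u\<^sub>0 = V 2 \<bullet> \<sigma> + \<nu> * u\<^sub>0"
    using balance_u0[OF m] by (simp add: c_def W_def inner_add_left algebra_simps numeral_2_eq_2)
  then have "V 1 v* (mat \<delta> - S) = (c 1 - \<delta> * u\<^sub>0) *\<^sub>R \<alpha>"
    using balance_V[of 1] m by (simp add: scaleR_add_left numeral_2_eq_2)
  then show ?thesis
    using delta_pos by (simp add: mult_resolvent_eq_iff scaleR_vector_matrix_assoc)
qed

lemma sum_c: "(\<Sum>q\<in>{1..m}. c q) = c m * Y"
proof -
  have "(\<Sum>q\<in>{1..m}. c q) = (\<Sum>k<m. c (m - k))"
    by (rule sum.reindex_bij_witness[of _ "\<lambda>k. m - k" "\<lambda>q. m - q"]) auto
  also have "\<dots> = c m * Y"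
    by (simp add: c_geometric sum_distrib_left mult.commute)
  finally show ?thesis .
qed

lemma sum_W: "V 1 + (\<Sum>q\<in>{1..<m}. W q) = K *\<^sub>R a"
proof -
  have "(\<Sum>q\<in>{1..<m}. W q) = (\<Sum>q\<in>{1..<m}. c (q + 1)) *\<^sub>R a"
    by (simp add: W_eq scaleR_sum_left)
  also have "(\<Sum>q\<in>{1..<m}. c (q + 1)) = (\<Sum>q\<in>{1..m}. c q) - c 1"
    using m sum.head[of 1 m c] sum.shift_bounds_Suc_ivl[of c 1 m]
    by (simp add: atLeastSucAtMost_greaterThanAtMost[symmetric] atLeastLessThanSuc_atLeastAtMost)
  finally show ?thesis
    unfolding V_1 sum_c K_def by (simp add: algebra_simps)
qed

text \<open>Each \<open>U q\<close> below the top pairs with \<open>V (q + 1)\<close>; only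
  \<open>V 1\<close> has no partner.\<close>

lemma sum_W_eq: "(\<Sum>q\<in>{1..<m}. U q) + (\<Sum>q\<in>{1..m}. V q) = V 1 + (\<Sum>q\<in>{1..<m}. W q)"
proof -
  have "(\<Sum>q\<in>{1..m}. V q) = V 1 + (\<Sum>q\<in>{1..<m}. V (q + 1))"
    using m sum.head[of 1 m V] sum.shift_bounds_Suc_ivl[of V 1 m]
    by (simp add: atLeastSucAtMost_greaterThanAtMost[symmetric] atLeastLessThanSuc_atLeastAtMost)
  then show ?thesis by (simp add: W_def sum.distrib)
qed

lemma U_top: "U m v* (mat \<nu> - S) = \<delta> *\<^sub>R (K *\<^sub>R a + idle *\<^sub>R \<alpha>)"
  using balance_U_top[OF m] unfolding sum_W_eq sum_W .

text \<open>Assignments from \<open>U m\<close> to \<open>V (m + 1)\<close> are internal to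
  \<open>W m\<close>; only the probe inflow from lower levels and idle states remains.\<close>

lemma W_top: "W m v* (mat 0 - S) = \<delta> *\<^sub>R (K *\<^sub>R a + idle *\<^sub>R \<alpha>)"
proof -
  have "W m v* (mat 0 - S) = U m v* (mat 0 - S) + \<nu> *\<^sub>R U m"
    using balance_V_top m by (simp add: W_def vector_matrix_left_distrib)
  then show ?thesis
    using shift_resolvent[of "U m" \<nu> 0] U_top by simp
qed

text \<open>By \<open>reset_mean\<close> the top level adds \<open>K * (1 - a \<bullet> 1)\<close>
  to the \<open>K * (a \<bullet> 1)\<close> of the lower levels; its other share is
  \<open>\<delta> * idle\<close>.\<close>

lemma mass_K: "mass = (1 + \<delta>) * idle + K"
proof -
  have "mass = idle + ((\<Sum>q\<in>{1..<m}. U q) + (\<Sum>q\<in>{1..m}. V q) + W m) \<bullet> 1"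
    using m unfolding mass_eq
    by (simp add: W_def inner_add_left inner_sum_left sum.last_plus atLeastLessThanSuc_atLeastAtMost[symmetric])
  also have "\<dots> = idle + K * (a \<bullet> 1) + W m \<bullet> 1"
    unfolding sum_W_eq sum_W by (simp add: inner_add_left)
  also have "W m \<bullet> 1 = K * (\<delta> * (a \<bullet> (R 0 *v 1))) + \<delta> * idle"
    by (simp add: inner_one_eq[OF W_top] inner_add_left mean_R algebra_simps)
  finally show ?thesis
    using reset_mean[OF delta_pos mean] by (simp add: algebra_simps)
qed

lemma idle_eq: "\<delta> * idle = (1 - y) * (\<delta> * u\<^sub>0) + y ^ m * c m"
proof -
  have "\<delta> * v\<^sub>0 = (c 1 - \<delta> * u\<^sub>0) * y"
    using balance_v0 delta_pos unfolding V_1 by (simp add: reset_exit)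
  moreover have "c 1 = y ^ (m - 1) * c m"
    using c_geometric[of "m - 1"] m by simp
  moreover have "y ^ m = y * y ^ (m - 1)"
    using m by (simp flip: power_Suc)
  ultimately show ?thesis by (simp add: algebra_simps)
qed

lemma u0_eq: "(\<delta> + \<nu>) * u\<^sub>0 = z ^ (m - 1) * (\<delta> * (K * (a \<bullet> h \<nu>) + idle * (\<alpha> \<bullet> h \<nu>)))"
  using balance_u0[OF m] exit_U_geometric[of "m - 1"] m inner_exit_rates[OF nu_nonneg U_top]
  by (simp add: inner_add_left)

text \<open>Equates two expressions for \<open>\<delta> * u\<^sub>0\<close>: one from
  \<open>idle_eq\<close> and the definition of \<open>K\<close>, with \<open>c m\<close> eliminated,
  the other from the geometric decay of \<open>U\<close>.\<close>

lemma K_idle: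
  "K * (\<delta>\<^sup>2 * theta \<delta> m \<nu> * (a \<bullet> h \<nu>) + y ^ m) = \<delta> * (Y - \<delta> * theta \<delta> m \<nu> * (\<alpha> \<bullet> h \<nu>)) * idle"
proof -
  have "Y * (\<delta> * idle) = ((1 - y) * Y) * (\<delta> * u\<^sub>0) + y ^ m * c m * Y"
    unfolding idle_eq by (simp only: algebra_simps)
  also have "(1 - y) * Y = 1 - y ^ m"
    by (simp add: one_diff_power_eq)
  finally have "\<delta> * u\<^sub>0 = \<delta> * Y * idle - y ^ m * K"
    unfolding K_def by (simp add: algebra_simps)
  moreover have "u\<^sub>0 = theta \<delta> m \<nu> * (\<delta> * (K * (a \<bullet> h \<nu>) + idle * (\<alpha> \<bullet> h \<nu>)))"
    using u0_eq delta_pos nu_nonneg by (simp add: theta_def field_simps)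
  ultimately have "\<delta> * Y * idle - y ^ m * K
      = \<delta> * (theta \<delta> m \<nu> * (\<delta> * (K * (a \<bullet> h \<nu>) + idle * (\<alpha> \<bullet> h \<nu>))))"
    by (simp only:)
  then show ?thesis
    by (simp add: power2_eq_square algebra_simps)
qed

end

end

subsection \<open>The idle probability as a function of the assignment rate\<close>

text \<open>Passes from the powers of \<open>1 / y\<close> in \<open>level\<close> to the powers of
  \<open>y\<close> in \<open>kappa\<close>.\<close>

lemma sum_inverse_powers:
  fixes y :: real
  assumes "y \<noteq> 0"
  shows "(\<Sum>k<Suc n. (1 / y) ^ k) = 1 + (\<Sum>k<n. y ^ k) / y ^ n"
proof (induction n)
  case (Suc n)
  have "(\<Sum>k<Suc n. y ^ k) = 1 + y * (\<Sum>k<n. y ^ k)"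
    by (simp add: sum.lessThan_Suc_shift sum_distrib_left del: sum.lessThan_Suc)
  then have "(\<Sum>k<Suc n. y ^ k) / y ^ Suc n = (1 / y) ^ Suc n + (\<Sum>k<n. y ^ k) / y ^ n"
    using assms by (simp add: add_divide_distrib power_one_over del: sum.lessThan_Suc)
  with Suc show ?case by simp
qed simp

context phase_type_law
begin

definition level :: "real \<Rightarrow> nat \<Rightarrow> real" where
  "level \<delta> m = 1 + \<delta> * (\<Sum>k<m. (1 / (\<alpha> \<bullet> h \<delta>)) ^ k)"

lemma alpha_ne_0: "\<alpha> \<noteq> 0"
  using sum_alpha by auto

context
  fixes \<delta> :: real
  assumes \<delta>: "0 < \<delta>"
begin

lemma reset_nonneg: "0 \<le> (\<alpha> v* R \<delta>) $ i"
  using \<delta> by (intro mult_R_nonneg alpha_nonneg) auto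

lemma reset_ne_0: "\<alpha> v* R \<delta> \<noteq> 0"
  using \<delta> alpha_ne_0 mult_R_resolvent[of \<delta> \<alpha>] by auto

lemma y_pos: "0 < \<alpha> \<bullet> h \<delta>"
  using \<delta> by (intro inner_h_pos alpha_nonneg alpha_ne_0) auto

lemma y_less_one: "\<alpha> \<bullet> h \<delta> < 1"
proof -
  have "0 < (\<alpha> v* R \<delta>) \<bullet> h 0"
    by (intro inner_h_pos reset_nonneg reset_ne_0) auto
  then show ?thesis
    using \<delta> reset_one[OF \<delta>] by (simp add: h_0) (metis diff_gt_0_iff_gt mult_pos_pos)
qed

lemma inner_alpha_h_le_one: "0 \<le> t \<Longrightarrow> \<alpha> \<bullet> h t \<le> 1"
  using inner_h_antimono[OF alpha_nonneg, of 0 t] by (simp add: h_0 inner_alpha_one)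

lemma theta_pos: "0 \<le> \<nu> \<Longrightarrow> 0 < theta \<delta> m \<nu>"
  unfolding theta_def using \<delta> by (intro divide_pos_pos zero_less_power inner_h_pos alpha_nonneg alpha_ne_0) auto

lemma theta_less:
  assumes "0 \<le> \<nu>" "\<nu> < \<nu>'"
  shows "theta \<delta> m \<nu>' < theta \<delta> m \<nu>"
  unfolding theta_def
proof (rule frac_less2)
  show "(\<alpha> \<bullet> h (\<delta> + \<nu>')) ^ (m - 1) \<le> (\<alpha> \<bullet> h (\<delta> + \<nu>)) ^ (m - 1)"
    using assms \<delta> by (intro power_mono inner_h_antimono inner_h_nonneg alpha_nonneg) auto
  show "0 < (\<alpha> \<bullet> h (\<delta> + \<nu>')) ^ (m - 1)"
    using assms \<delta> by (intro zero_less_power inner_h_pos alpha_nonneg alpha_ne_0) auto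
qed (use assms \<delta> in auto)

lemma theta_le: "0 \<le> \<nu> \<Longrightarrow> theta \<delta> m \<nu> \<le> 1 / (\<delta> + \<nu>)"
  unfolding theta_def using \<delta>
  by (intro divide_right_mono power_le_one inner_alpha_h_le_one inner_h_nonneg alpha_nonneg) auto

lemma continuous_on_inner_alpha_h [continuous_intros]:
  "continuous_on A f \<Longrightarrow> f ` A \<subseteq> {0..} \<Longrightarrow> continuous_on A (\<lambda>x. \<alpha> \<bullet> h (f x))"
  by (rule continuous_on_compose2[OF continuous_on_inner_h[OF alpha_nonneg]])

lemma continuous_on_theta: "continuous_on {0..} (theta \<delta> m)"
  unfolding theta_def using \<delta> by (intro continuous_intros) auto

definition "kappa_num m \<nu> = (\<Sum>k<m. (\<alpha> \<bullet> h \<delta>) ^ k) - \<delta> * theta \<delta> m \<nu> * (\<alpha> \<bullet> h \<nu>)"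
definition "kappa_den m \<nu> = \<delta>\<^sup>2 * theta \<delta> m \<nu> * ((\<alpha> v* R \<delta>) \<bullet> h \<nu>) + (\<alpha> \<bullet> h \<delta>) ^ m"

lemma kappa_alt: "kappa \<delta> m \<nu> = \<delta> * (kappa_num m \<nu> / kappa_den m \<nu>)"
  by (simp add: kappa_def kappa_num_def kappa_den_def)

lemma kappa_den_ge: "0 \<le> \<nu> \<Longrightarrow> (\<alpha> \<bullet> h \<delta>) ^ m \<le> kappa_den m \<nu>"
  unfolding kappa_den_def using theta_pos[of \<nu> m] inner_h_nonneg[of "\<alpha> v* R \<delta>" \<nu>] reset_nonneg by simp

lemma kappa_den_pos: "0 \<le> \<nu> \<Longrightarrow> 0 < kappa_den m \<nu>"
  using kappa_den_ge[of \<nu> m] zero_less_power[OF y_pos, of m] by linarith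

lemma theta_inner_less:
  assumes "0 \<le> \<nu>" "\<nu> < \<nu>'"
  shows "theta \<delta> m \<nu>' * (\<alpha> \<bullet> h \<nu>') < theta \<delta> m \<nu> * (\<alpha> \<bullet> h \<nu>)"
  using assms theta_less[OF assms, of m] theta_pos[of \<nu>' m]
  by (intro mult_less_le_imp_less inner_h_antimono inner_h_pos alpha_nonneg alpha_ne_0) auto

lemma kappa_den_antimono:
  assumes "0 \<le> \<nu>" "\<nu> < \<nu>'"
  shows "kappa_den m \<nu>' \<le> kappa_den m \<nu>"
proof -
  have "theta \<delta> m \<nu>' * ((\<alpha> v* R \<delta>) \<bullet> h \<nu>') \<le> theta \<delta> m \<nu> * ((\<alpha> v* R \<delta>) \<bullet> h \<nu>)"
    using assms theta_less[OF assms, of m] theta_pos[of \<nu> m]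
    by (intro mult_mono inner_h_antimono inner_h_nonneg reset_nonneg) auto
  then show ?thesis
    unfolding kappa_den_def mult.assoc using \<delta> by (simp add: mult_left_mono)
qed

lemma kappa_num_less: "0 \<le> \<nu> \<Longrightarrow> \<nu> < \<nu>' \<Longrightarrow> kappa_num m \<nu> < kappa_num m \<nu>'"
  unfolding kappa_num_def mult.assoc using theta_inner_less[of \<nu> \<nu>' m] \<delta> by simp

lemma kappa_num_0: "kappa_num (Suc n) 0 = (\<Sum>k<n. (\<alpha> \<bullet> h \<delta>) ^ k)"
  using \<delta> by (simp add: kappa_num_def theta_def h_0 inner_alpha_one)

text \<open>Writing \<open>y\<close> for \<open>\<alpha> \<bullet> h \<delta>\<close>, the summands
  are \<open>y ^ n * (1 - y)\<close>, by \<open>reset_one\<close>, and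
  \<open>y ^ Suc n\<close>.\<close>

lemma kappa_den_0: "kappa_den (Suc n) 0 = (\<alpha> \<bullet> h \<delta>) ^ n"
proof -
  have "kappa_den (Suc n) 0 = (\<alpha> \<bullet> h \<delta>) ^ n * (\<delta> * ((\<alpha> v* R \<delta>) \<bullet> 1)) + (\<alpha> \<bullet> h \<delta>) ^ Suc n"
    using \<delta> by (simp add: kappa_den_def theta_def h_0 power2_eq_square)
  then show ?thesis
    unfolding reset_one[OF \<delta>] by (simp add: algebra_simps)
qed

text \<open>Comparing quotients in \<open>kappa_less\<close> requires this sign. It holds at 0 and
  persists by monotonicity; the index is a successor because at index 0 the numerator is
  negative.\<close>

lemma kappa_num_nonneg:
  assumes "0 \<le> \<nu>"
  shows "0 \<le> kappa_num (Suc n) \<nu>"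
proof -
  have "kappa_num (Suc n) 0 \<le> kappa_num (Suc n) \<nu>"
    using assms kappa_num_less[of 0 \<nu> "Suc n"] by (cases "\<nu> = 0") auto
  moreover have "0 \<le> kappa_num (Suc n) 0"
    unfolding kappa_num_0 using y_pos by (intro sum_nonneg) auto
  ultimately show ?thesis by simp
qed

lemma kappa_nonneg: "0 \<le> \<nu> \<Longrightarrow> 0 \<le> kappa \<delta> (Suc n) \<nu>"
  unfolding kappa_alt using \<delta> kappa_num_nonneg kappa_den_pos
  by (intro mult_nonneg_nonneg divide_nonneg_pos) auto

lemma kappa_less:
  assumes "0 \<le> \<nu>" "\<nu> < \<nu>'"
  shows "kappa \<delta> (Suc n) \<nu> < kappa \<delta> (Suc n) \<nu>'"
proof -
  have "kappa_num (Suc n) \<nu> / kappa_den (Suc n) \<nu> < kappa_num (Suc n) \<nu>' / kappa_den (Suc n) \<nu>'"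
    using assms by (intro frac_less kappa_num_nonneg kappa_num_less kappa_den_antimono kappa_den_pos) auto
  then show ?thesis unfolding kappa_alt using \<delta> by (rule mult_strict_left_mono)
qed

lemma continuous_on_kappa: "continuous_on {0..} (kappa \<delta> m)"
proof -
  have "continuous_on {0..} (kappa_num m)" "continuous_on {0..} (kappa_den m)"
    unfolding kappa_num_def kappa_den_def
    by (intro continuous_intros continuous_on_theta continuous_on_inner_h reset_nonneg; simp)+
  then show ?thesis
    unfolding kappa_alt using kappa_den_pos
    by (intro continuous_intros) (auto simp: less_imp_neq[symmetric])
qed

lemma tendsto_theta: "((\<lambda>\<nu>. theta \<delta> m \<nu>) \<longlongrightarrow> 0) at_top"
proof (rule tendsto_sandwich[of "\<lambda>_. 0" _ _ "\<lambda>\<nu>. 1 / (\<delta> + \<nu>)"])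
  show "((\<lambda>\<nu>. 1 / (\<delta> + \<nu>)) \<longlongrightarrow> 0) at_top"
    by (intro tendsto_divide_0[OF tendsto_const] filterlim_at_top_imp_at_infinity
        filterlim_tendsto_add_at_top[OF tendsto_const] filterlim_ident)
  show "\<forall>\<^sub>F \<nu> in at_top. 0 \<le> theta \<delta> m \<nu>" "\<forall>\<^sub>F \<nu> in at_top. theta \<delta> m \<nu> \<le> 1 / (\<delta> + \<nu>)"
    using theta_pos[of _ m] theta_le[of _ m]
    by (auto intro!: eventually_mono[OF eventually_ge_at_top[of 0]] simp: less_imp_le)
qed auto

lemma tendsto_theta_inner:
  assumes "\<And>i. 0 \<le> b $ i"
  shows "((\<lambda>\<nu>. theta \<delta> m \<nu> * (b \<bullet> h \<nu>)) \<longlongrightarrow> 0) at_top"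
proof (rule tendsto_sandwich[of "\<lambda>_. 0" _ _ "\<lambda>\<nu>. theta \<delta> m \<nu> * (b \<bullet> h 0)"])
  show "((\<lambda>\<nu>. theta \<delta> m \<nu> * (b \<bullet> h 0)) \<longlongrightarrow> 0) at_top"
    by (intro tendsto_mult_left_zero tendsto_theta)
  show "\<forall>\<^sub>F \<nu> in at_top. 0 \<le> theta \<delta> m \<nu> * (b \<bullet> h \<nu>)"
    "\<forall>\<^sub>F \<nu> in at_top. theta \<delta> m \<nu> * (b \<bullet> h \<nu>) \<le> theta \<delta> m \<nu> * (b \<bullet> h 0)"
    using theta_pos[of _ m] inner_h_nonneg[OF assms] inner_h_antimono[OF assms, of 0]
    by (auto intro!: eventually_mono[OF eventually_ge_at_top[of 0]] mult_nonneg_nonneg mult_left_mono simp: less_imp_le)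
qed auto

lemma tendsto_kappa:
  "(kappa \<delta> m \<longlongrightarrow> \<delta> * ((\<Sum>k<m. (\<alpha> \<bullet> h \<delta>) ^ k) / (\<alpha> \<bullet> h \<delta>) ^ m)) at_top"
proof -
  have "(kappa_num m \<longlongrightarrow> (\<Sum>k<m. (\<alpha> \<bullet> h \<delta>) ^ k) - \<delta> * 0) at_top"
    unfolding kappa_num_def mult.assoc
    by (intro tendsto_intros tendsto_theta_inner alpha_nonneg)
  moreover have "(kappa_den m \<longlongrightarrow> \<delta>\<^sup>2 * 0 + (\<alpha> \<bullet> h \<delta>) ^ m) at_top"
    unfolding kappa_den_def mult.assoc
    by (intro tendsto_intros tendsto_theta_inner reset_nonneg)
  ultimately show ?thesis
    unfolding kappa_alt using y_pos by (intro tendsto_mult tendsto_divide tendsto_const) auto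
qed

text \<open>This form is both the value for index \<open>Suc n\<close> at \<open>\<nu> = 0\<close>
  and the limit for index \<open>n\<close> at infinity, so consecutive intervals meet.\<close>

lemma level_Suc: "level \<delta> (Suc n) = 1 + \<delta> + \<delta> * ((\<Sum>k<n. (\<alpha> \<bullet> h \<delta>) ^ k) / (\<alpha> \<bullet> h \<delta>) ^ n)"
  unfolding level_def using y_pos by (subst sum_inverse_powers) (auto simp: algebra_simps)

lemma inv_idle_0: "inv_idle \<delta> m 0 = level \<delta> m"
  by (cases m) (auto simp: inv_idle_def kappa_alt kappa_num_0 kappa_den_0 level_Suc, simp add: level_def)

lemma inv_idle_less:
  assumes "0 \<le> \<nu>" "\<nu> < \<nu>'"
  shows "inv_idle \<delta> m \<nu> < inv_idle \<delta> m \<nu>'"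
proof (cases m)
  case 0
  have "\<nu> / (\<delta> + \<nu>) < \<nu>' / (\<delta> + \<nu>')"
    using assms \<delta> by (simp add: divide_simps) (simp add: algebra_simps)
  with 0 \<delta> show ?thesis by (simp add: inv_idle_def flip: times_divide_eq_right)
next
  case (Suc n)
  with assms show ?thesis by (simp add: inv_idle_def kappa_less)
qed

lemma continuous_on_inv_idle: "continuous_on {0..} (inv_idle \<delta> m)"
proof (cases m)
  case 0
  then show ?thesis
    unfolding inv_idle_def using \<delta> by (auto intro!: continuous_intros)
next
  case (Suc n)
  then show ?thesis
    unfolding inv_idle_def by (auto intro!: continuous_intros continuous_on_kappa)
qed

lemma tendsto_inv_idle: "(inv_idle \<delta> m \<longlongrightarrow> level \<delta> (Suc m)) at_top"
proof (cases m)
  case 0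
  have "((\<lambda>\<nu>. 1 + \<delta> * \<nu> / (\<delta> + \<nu>)) \<longlongrightarrow> 1 + \<delta>) at_top"
    using \<delta> by real_asymp
  then show ?thesis by (simp add: 0 inv_idle_def[abs_def] level_Suc)
next
  case (Suc n)
  then show ?thesis
    using tendsto_add[OF tendsto_const[of "1 + \<delta>"] tendsto_kappa[of m]]
    unfolding inv_idle_def[abs_def] level_Suc by (simp del: power_Suc sum.lessThan_Suc)
qed

text \<open>The limit bounds the value at \<open>\<nu> + 1\<close> weakly; strict monotonicity makes
  the bound at \<open>\<nu>\<close> strict.\<close>

lemma inv_idle_less_level:
  assumes "0 \<le> \<nu>"
  shows "inv_idle \<delta> m \<nu> < level \<delta> (Suc m)"
proof -
  have "inv_idle \<delta> m (\<nu> + 1) \<le> level \<delta> (Suc m)"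
    using assms inv_idle_less[of "\<nu> + 1" _ m]
    by (intro tendsto_lowerbound[OF tendsto_inv_idle] eventually_mono[OF eventually_gt_at_top[of "\<nu> + 1"]])
      (auto simp: less_imp_le)
  then show ?thesis using inv_idle_less[of \<nu> "\<nu> + 1" m] assms by simp
qed

lemma level_le_inv_idle: "0 \<le> \<nu> \<Longrightarrow> level \<delta> m \<le> inv_idle \<delta> m \<nu>"
  using inv_idle_less[of 0 \<nu> m] by (cases "\<nu> = 0") (auto simp: inv_idle_0)

lemma level_ge_one: "1 \<le> level \<delta> m"
  unfolding level_def using \<delta> y_pos by (auto intro!: mult_nonneg_nonneg sum_nonneg)

lemma inv_idle_pos: "0 \<le> \<nu> \<Longrightarrow> 0 < inv_idle \<delta> m \<nu>"
  using level_le_inv_idle[of \<nu> m] level_ge_one[of m] by linarith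

text \<open>Intermediate value theorem on \<open>{0..b}\<close>; a suitable \<open>b\<close> exists
  because the limit at infinity exceeds \<open>x\<close>.\<close>

lemma ex_inv_idle:
  assumes "level \<delta> m \<le> x" "x < level \<delta> (Suc m)"
  shows "\<exists>\<nu>\<ge>0. inv_idle \<delta> m \<nu> = x"
proof -
  have "\<forall>\<^sub>F \<nu> in at_top. x < inv_idle \<delta> m \<nu> \<and> 0 \<le> \<nu>"
    by (intro eventually_conj order_tendstoD(1)[OF tendsto_inv_idle] assms eventually_ge_at_top)
  then obtain b where b: "x < inv_idle \<delta> m b" "0 \<le> b"
    by (metis (mono_tags, lifting) eventually_happens trivial_limit_at_top_linorder)
  have "continuous_on {0..b} (inv_idle \<delta> m)"
    by (rule continuous_on_subset[OF continuous_on_inv_idle]) auto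
  then show ?thesis
    using IVT'[of "inv_idle \<delta> m" 0 x b] assms b by (auto simp: inv_idle_0)
qed

end

end

subsection \<open>The stationary distribution\<close>

lemma (in phase_type_law) eq_0_of_mult_resolvent: "0 \<le> t \<Longrightarrow> x v* (mat t - S) = 0 \<Longrightarrow> x = 0"
  by (metis mult_resolvent_eq_iff vector_matrix_mult_0)

context push_balance
begin

lemma K_eq:
  assumes "1 \<le> m"
  shows "K = kappa \<delta> m \<nu> * idle"
proof -
  have "K * kappa_den \<delta> m \<nu> = \<delta> * kappa_num \<delta> m \<nu> * idle"
    using K_idle[OF assms] by (simp only: kappa_den_def[OF delta_pos] kappa_num_def[OF delta_pos])
  then show ?thesis
    using kappa_den_pos[OF delta_pos nu_nonneg, of m] by (simp add: kappa_alt[OF delta_pos] field_simps)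
qed

lemma mass_0:
  assumes "m = 0"
  shows "mass = inv_idle \<delta> m \<nu> * idle"
proof -
  have "V 1 \<bullet> 1 = \<nu> * u\<^sub>0"
    using inner_one_eq[OF balance_V_top] assms by (simp add: mean_R)
  then have "mass = idle + \<nu> * u\<^sub>0"
    unfolding mass_eq using assms by simp
  moreover have "\<nu> * u\<^sub>0 = \<delta> * \<nu> / (\<delta> + \<nu>) * idle"
    using balance_u0'[OF assms] delta_pos nu_nonneg by (simp add: field_simps)
  ultimately show ?thesis
    unfolding inv_idle_def using assms by (simp add: algebra_simps)
qed

lemma mass_inv_idle: "mass = inv_idle \<delta> m \<nu> * idle"
proof (cases "m = 0")
  case False
  then show ?thesis
    using mass_K K_eq by (simp add: inv_idle_def algebra_simps)
qed (rule mass_0)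

text \<open>With \<open>idle = 0\<close> also \<open>K = 0\<close>, so the source of
  \<open>U m\<close> vanishes, and zeros propagate down through \<open>U\<close> and then through
  \<open>V\<close>. The argument is linear, as signed differences require.\<close>

lemma eq_0_of_idle_eq_0:
  assumes "idle = 0" "s \<in> push_states m"
  shows "p s = 0"
proof -
  have UV: "V (m + 1) = 0 \<and> u\<^sub>0 = 0 \<and> (\<forall>q. 1 \<le> q \<and> q \<le> m \<longrightarrow> U q = 0)"
  proof (cases "m = 0")
    case True
    then have "(\<delta> + \<nu>) * u\<^sub>0 = 0"
      using balance_u0'[OF True] assms(1) by (simp add: algebra_simps) (metis add.inverse_inverse add_eq_0_iff mult_minus_right)
    then have "u\<^sub>0 = 0" using delta_pos nu_nonneg by auto
    then have "V (m + 1) v* (mat 0 - S) = 0"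
      unfolding balance_V_top using True by simp
    then show ?thesis
      using True \<open>u\<^sub>0 = 0\<close> eq_0_of_mult_resolvent[of 0] by simp
  next
    case False
    then have m: "1 \<le> m" by simp
    have "U m v* (mat \<nu> - S) = 0"
      unfolding U_top[OF m] K_eq[OF m] using assms(1) by simp
    then have U_m: "U m = 0"
      by (rule eq_0_of_mult_resolvent[OF nu_nonneg])
    have exit: "U (q + 1) \<bullet> \<sigma> = 0" if "q < m" for q
      using exit_U_geometric[of "m - (q + 1)"] that U_m by simp
    have "U q = 0" if "1 \<le> q" "q \<le> m" for q
    proof (cases "q = m")
      case False
      then have "U q v* (mat (\<delta> + \<nu>) - S) = 0"
        using balance_U[of q] that exit[of q] by simp
      then show ?thesis
        using delta_pos nu_nonneg eq_0_of_mult_resolvent[of "\<delta> + \<nu>"] by simp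
    qed (simp add: U_m)
    moreover have "V (m + 1) v* (mat 0 - S) = 0"
      unfolding balance_V_top using m U_m by simp
    then have "V (m + 1) = 0"
      by (rule eq_0_of_mult_resolvent[OF order_refl])
    moreover have "u\<^sub>0 = 0"
      using balance_u0[OF m] exit[of 0] m delta_pos nu_nonneg by simp
    ultimately show ?thesis by simp
  qed
  \<comment> \<open>Descends from the top: the source of \<open>V q\<close> involves only
    \<open>V (q + 1)\<close> and either \<open>U (q - 1)\<close> or
    \<open>u\<^sub>0\<close>.\<close>
  have V: "V (m + 1 - k) = 0" if "k \<le> m" for k
    using that
  proof (induction k)
    case (Suc k)
    define q where "q = m - k"
    have q: "1 \<le> q" "q \<le> m" using Suc.prems by (auto simp: q_def)
    have "V (q + 1) = 0"
      using Suc by (simp add: q_def Suc_diff_le)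
    moreover have "U (q - 1) = 0" if "q \<noteq> 1"
    proof -
      have "1 \<le> q - 1 \<and> q - 1 \<le> m" using q that by auto
      with UV show ?thesis by blast
    qed
    ultimately have "V q v* (mat \<delta> - S) = 0"
      using balance_V[OF q] UV by simp
    then have "V q = 0"
      using delta_pos eq_0_of_mult_resolvent[of \<delta>] by simp
    then show ?case by (simp add: q_def)
  qed (use UV in simp)
  have "v\<^sub>0 = 0"
    using assms(1) UV by simp
  moreover have "p (Busy q m j) = 0" if "1 \<le> q" "q \<le> m" for q j
    using UV that by (auto simp: U_def vec_eq_iff)
  moreover have "p (Busy q (m + 1) j) = 0" if "1 \<le> q" "q \<le> m + 1" for q j
    using V[of "m + 1 - q"] that by (auto simp: V_def vec_eq_iff)
  ultimately show ?thesis
    using assms(2) UV by (auto simp: push_states_def)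
qed

context
  assumes nonneg: "\<And>s. 0 \<le> p s" and mass_one: "mass = 1"
begin

lemma idle_pos: "0 < idle"
proof -
  have "idle \<noteq> 0"
    using mass_inv_idle mass_one by auto
  then show ?thesis
    using nonneg[of "Idle m"] nonneg[of "Idle (m + 1)"] by linarith
qed

text \<open>If \<open>U m\<close> vanished, so would its source; paired with 1, this is a
  nonnegative term plus the positive \<open>idle\<close>.\<close>

lemma U_top_ne_0:
  assumes m: "1 \<le> m"
  shows "U m \<noteq> 0"
proof
  assume "U m = 0"
  then have "K *\<^sub>R a + idle *\<^sub>R \<alpha> = 0"
    using U_top[OF m] delta_pos by simp
  then have "(K *\<^sub>R a + idle *\<^sub>R \<alpha>) \<bullet> 1 = 0"
    by (simp only: inner_zero_left)
  then have "K * (a \<bullet> 1) + idle = 0"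
    unfolding inner_add_left inner_scaleR_left inner_alpha_one by simp
  moreover have "0 \<le> K"
    unfolding K_eq[OF m] using kappa_nonneg[OF delta_pos nu_nonneg, of "m - 1"] m idle_pos by simp
  moreover have "0 \<le> a \<bullet> 1"
    using reset_nonneg[OF delta_pos] by (intro inner_vec_nonneg) auto
  ultimately show False
    using idle_pos mult_nonneg_nonneg[of K "a \<bullet> 1"] by linarith
qed

lemma V_top_ne_0:
  assumes "0 < \<nu>"
  shows "V (m + 1) \<noteq> 0"
proof
  assume "V (m + 1) = 0"
  then have 0: "(if m = 0 then u\<^sub>0 *\<^sub>R \<alpha> else U m) = 0"
    using balance_V_top assms by simp
  show False
  proof (cases "m = 0")
    case True
    with 0 have "u\<^sub>0 = 0" using alpha_ne_0 by simp
    with True show False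
      using balance_u0' delta_pos idle_pos by simp
  next
    case False
    with 0 show False using U_top_ne_0 by simp
  qed
qed

lemma V_top_eq_0:
  assumes "\<nu> = 0"
  shows "V (m + 1) = 0"
proof (rule eq_0_of_mult_resolvent[OF order_refl])
  show "V (m + 1) v* (mat 0 - S) = 0"
    unfolding balance_V_top using assms by simp
qed

end

end

section \<open>Existence, uniqueness and the largest queue length\<close>

context phase_type_law
begin

context
  fixes \<delta> :: real
  assumes \<delta>: "0 < \<delta>" and mean: "ph_mean \<alpha> S = 1"
begin

lemma push_balanceI:
  assumes "0 \<le> \<nu>" "push_stationary \<alpha> S \<delta> m \<nu> p"
  shows "push_balance \<alpha> S \<delta> \<nu> m p"
  using assms \<delta> mean by unfold_locales (auto simp: push_stationary_def)

lemma push_stationary_unique: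
  assumes \<nu>: "0 \<le> \<nu>" and p: "push_stationary \<alpha> S \<delta> m \<nu> p" and p': "push_stationary \<alpha> S \<delta> m \<nu> p'"
  shows "p = p'"
proof
  fix s
  \<comment> \<open>The difference has mass 0, so \<open>mass_inv_idle\<close> forces its
    \<open>idle\<close> to vanish.\<close>
  define d where "d s = p s - p' s" for s
  interpret push_balance \<alpha> S \<delta> \<nu> m d
    using p p' \<delta> \<nu> mean
    by unfold_locales (simp_all add: d_def push_stationary_def left_diff_distrib sum_subtractf)
  have "mass = 0"
    using p p' by (simp add: d_def sum_subtractf push_stationary_def)
  then have "idle = 0"
    using mass_inv_idle inv_idle_pos[OF \<delta> \<nu>, of m] by auto
  then show "p s = p' s"
    using eq_0_of_idle_eq_0[of s] p p' by (cases "s \<in> push_states m") (auto simp: d_def push_stationary_def)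
qed

lemma push_rate_nonneg:
  assumes "0 \<le> \<nu>"
  shows "0 \<le> push_rate \<alpha> S \<delta> m \<nu> s s'"
proof -
  have if_nonneg: "0 \<le> (if P then c else 0)" if "P \<Longrightarrow> 0 \<le> c" for P and c :: real
    using that by simp
  show ?thesis
    using \<delta> assms
    by (cases s; cases s'; simp only: push_rate.simps)
      (intro add_nonneg_nonneg if_nonneg mult_nonneg_nonneg S_off_diagonal alpha_nonneg exit_rates_nonneg; simp)+
qed

lemma ex_push_stationary:
  assumes \<nu>: "0 \<le> \<nu>"
  shows "\<exists>p. push_stationary \<alpha> S \<delta> m \<nu> p"
proof -
  have "push_states m \<noteq> ({} :: 'n state set)"
    by (auto simp: push_states_def)
  from ex_stationary_measure[of "push_states m" "push_rate \<alpha> S \<delta> m \<nu>",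
      OF finite_push_states this push_rate_nonneg[OF \<nu>]]
  obtain p where p: "\<forall>s\<in>push_states m. 0 \<le> p s" "0 < sum p (push_states m)"
    "\<forall>s\<in>push_states m. p s * (\<Sum>s'\<in>push_states m. push_rate \<alpha> S \<delta> m \<nu> s s')
          = (\<Sum>s'\<in>push_states m. p s' * push_rate \<alpha> S \<delta> m \<nu> s' s)"
    by (elim exE conjE)
  define T where "T = sum p (push_states m)"
  \<comment> \<open>The value 0 outside \<open>push_states m\<close> is what makes the stationary
    function unique, as \<open>THE\<close> requires.\<close>
  define p' where "p' s = (if s \<in> push_states m then p s / T else 0)" for s
  have "sum p' (push_states m) = 1"
    using p(2) by (simp add: p'_def T_def flip: sum_divide_distrib)
  moreover have "(\<Sum>s'\<in>push_states m. p' s' * f s') = (\<Sum>s'\<in>push_states m. p s' * f s') / T" for f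
    by (simp add: p'_def sum_divide_distrib)
  ultimately have "push_stationary \<alpha> S \<delta> m \<nu> p'"
    using p by (auto simp: push_stationary_def p'_def T_def)
  then show ?thesis by (rule exI[of _ p'])
qed

lemma push_stationary_push_dist:
  assumes "0 \<le> \<nu>"
  shows "push_stationary \<alpha> S \<delta> m \<nu> (push_dist \<alpha> S \<delta> m \<nu>)"
proof -
  obtain p where p: "push_stationary \<alpha> S \<delta> m \<nu> p"
    using ex_push_stationary[OF assms, of m] by (rule exE)
  show ?thesis
    unfolding push_dist_def
    by (rule theI[of "push_stationary \<alpha> S \<delta> m \<nu>" p, OF p push_stationary_unique[OF assms _ p]])
qed

lemma queue_prob_0:
  assumes "0 \<le> \<nu>"
  shows "queue_prob \<alpha> S \<delta> m \<nu> 0 = 1 / inv_idle \<delta> m \<nu>"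
proof -
  define p where "p = push_dist \<alpha> S \<delta> m \<nu>"
  have stat: "push_stationary \<alpha> S \<delta> m \<nu> p"
    unfolding p_def using assms by (rule push_stationary_push_dist)
  interpret push_balance \<alpha> S \<delta> \<nu> m p
    using assms stat by (rule push_balanceI)
  have "{s \<in> push_states m. queue_length s = 0} = {Idle m, Idle (m + 1) :: 'n state}"
    by (auto simp: push_states_def)
  then have "queue_prob \<alpha> S \<delta> m \<nu> 0 = idle"
    by (simp add: queue_prob_def p_def)
  moreover have "inv_idle \<delta> m \<nu> * idle = 1"
    using mass_inv_idle stat by (simp add: push_stationary_def)
  ultimately show ?thesis
    using inv_idle_pos[OF \<delta> assms, of m] by (simp add: field_simps)
qed

lemma queue_prob_pos_iff:
  assumes "0 \<le> \<nu>"
  shows "0 < queue_prob \<alpha> S \<delta> m \<nu> q \<longleftrightarrow>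
    (\<exists>s\<in>push_states m. queue_length s = q \<and> push_dist \<alpha> S \<delta> m \<nu> s \<noteq> 0)"
proof -
  have "0 \<le> push_dist \<alpha> S \<delta> m \<nu> s" for s
    using push_stationary_push_dist[OF assms, of m] by (simp add: push_stationary_def)
  then show ?thesis
    unfolding queue_prob_def
    by (subst less_le, subst eq_commute, subst sum_nonneg_eq_0_iff)
      (auto simp: finite_push_states sum_nonneg)
qed

lemma Greatest_queue_prob_pos:
  assumes \<nu>: "0 \<le> \<nu>"
  shows "(GREATEST q. 0 < queue_prob \<alpha> S \<delta> m \<nu> q) = (if \<nu> = 0 then m else m + 1)"
proof -
  define p where "p = push_dist \<alpha> S \<delta> m \<nu>"
  have stat: "push_stationary \<alpha> S \<delta> m \<nu> p"
    unfolding p_def using assms by (rule push_stationary_push_dist)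
  interpret push_balance \<alpha> S \<delta> \<nu> m p
    using \<nu> stat by (rule push_balanceI)
  have nonneg: "\<And>s. 0 \<le> p s" and mass: "mass = 1"
    using stat by (auto simp: push_stationary_def)
  have le: "queue_length s \<le> m + 1" if "s \<in> push_states m" for s :: "'n state"
    using that by (auto simp: push_states_def)
  show ?thesis
  proof (cases "\<nu> = 0")
    case True
    have "0 < queue_prob \<alpha> S \<delta> m \<nu> m"
    proof (cases "m = 0")
      case True
      then show ?thesis
        using queue_prob_0[OF \<nu>, of m] inv_idle_pos[OF \<delta> \<nu>, of m] by simp
    next
      case False
      then obtain j where "p (Busy m m j) \<noteq> 0"
        using U_top_ne_0[OF nonneg mass] by (auto simp: U_def vec_eq_iff)
      moreover have "Busy m m j \<in> push_states m"
        using False by (intro busy_mem) auto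
      ultimately show ?thesis
        unfolding queue_prob_pos_iff[OF \<nu>] p_def by force
    qed
    moreover have "q \<le> m" if q: "0 < queue_prob \<alpha> S \<delta> m \<nu> q" for q
    proof -
      obtain s where s: "s \<in> push_states m" "queue_length s = q" "p s \<noteq> 0"
        using q unfolding queue_prob_pos_iff[OF \<nu>] p_def by blast
      \<comment> \<open>Queue length \<open>m + 1\<close> occurs only together with estimate
        \<open>m + 1\<close>.\<close>
      have "p (Busy (m + 1) (m + 1) j) = 0" for j
        using V_top_eq_0[OF nonneg mass True] by (auto simp: V_def vec_eq_iff)
      then show ?thesis
        using s by (auto simp: push_states_def le_Suc_eq)
    qed
    ultimately show ?thesis
      using True by (auto intro: Greatest_equality)
  next
    case False
    then obtain j where "p (Busy (m + 1) (m + 1) j) \<noteq> 0"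
      using V_top_ne_0[OF nonneg mass] \<nu> by (auto simp: V_def vec_eq_iff)
    moreover have "Busy (m + 1) (m + 1) j \<in> push_states m"
      by (intro busy_mem) auto
    ultimately have "0 < queue_prob \<alpha> S \<delta> m \<nu> (m + 1)"
      unfolding queue_prob_pos_iff[OF \<nu>] p_def by force
    moreover have "q \<le> m + 1" if "0 < queue_prob \<alpha> S \<delta> m \<nu> q" for q
      using that le unfolding queue_prob_pos_iff[OF \<nu>] by blast
    ultimately show ?thesis
      using False by (auto intro: Greatest_equality)
  qed
qed

end

end

text \<open>The conclusion \<open>0 \<le> mt\<close> ensures that the conversions by
  \<open>nat\<close> lose nothing.\<close>

theorem theorem4p3:
  fixes \<alpha> :: "real ^ 'n" and S :: "real ^ 'n ^ 'n" and \<delta> lam y mt :: real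
  assumes "0 \<le> lam" and "lam < 1" and "0 < \<delta>"
    and "phase_type \<alpha> S" and "ph_mean \<alpha> S = 1"
    and "y = ph_before_exp \<alpha> S \<delta>"
    and "mt = ln (1 / y + (lam / (\<delta> * (1 - lam)) - 1) * ((1 - y) / y)) / ln (1 / y)"
  shows "0 \<le> mt
    \<and> 1 - lam \<in> {queue_prob \<alpha> S \<delta> (nat \<lceil>mt\<rceil>) 0 0 .. queue_prob \<alpha> S \<delta> (nat \<lfloor>mt\<rfloor>) 0 0}
    \<and> int (cavity_max_queue \<alpha> S \<delta> lam) = \<lceil>mt\<rceil>"
proof -
  interpret phase_type_law \<alpha> S by unfold_locales fact
  note \<delta> = \<open>0 < \<delta>\<close> and mean = \<open>ph_mean \<alpha> S = 1\<close>
  have y: "y = \<alpha> \<bullet> h \<delta>"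
    using reset_exit[OF \<delta>] assms(6) by (simp add: ph_before_exp_def R_def)
  have y01: "0 < y" "y < 1"
    using y_pos[OF \<delta>] y_less_one[OF \<delta>] by (simp_all add: y)
  define w where "w = 1 / y"
  have w: "1 < w" using y01 by (simp add: w_def)
  \<comment> \<open>The value that \<open>inv_idle\<close> has to attain.\<close>
  define x where "x = 1 / (1 - lam)"
  have x: "x - 1 = lam / (1 - lam)" "1 - lam = 1 / x" "1 \<le> x"
    using assms(1,2) by (auto simp: x_def field_simps)
  \<comment> \<open>The argument of the logarithm in \<open>mt\<close>, rearranged.\<close>
  define X where "X = 1 + (x - 1) / \<delta> * (w - 1)"
  have X: "1 \<le> X"
    unfolding X_def using x(3) w \<delta> by simp
  have eqs: "(1 - y) / y = w - 1" "1 / y = w" "lam / (\<delta> * (1 - lam)) = (x - 1) / \<delta>"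
    using y01 by (simp_all add: w_def diff_divide_distrib x(1) mult.commute)
  have mt: "mt = ln X / ln w"
    unfolding assms(7) X_def eqs by (simp add: algebra_simps)
  define G where "G n = (w ^ n - 1) / (w - 1)" for n
  have level: "level \<delta> n = 1 + \<delta> * G n" for n
    unfolding level_def G_def y[symmetric] eqs using w by (simp add: geometric_sum)
  \<comment> \<open>By the geometric sum, comparing \<open>level \<delta> n\<close> with
    \<open>x\<close> is comparing \<open>w ^ n\<close> with \<open>X\<close>; logarithms then bring
    in \<open>mt\<close>.\<close>
  have iff: "level \<delta> n \<le> x \<longleftrightarrow> real n \<le> mt" "level \<delta> n < x \<longleftrightarrow> real n < mt" for n
  proof -
    have "level \<delta> n \<le> x \<longleftrightarrow> G n \<le> (x - 1) / \<delta>" "level \<delta> n < x \<longleftrightarrow> G n < (x - 1) / \<delta>"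
      unfolding level pos_le_divide_eq[OF \<delta>] pos_less_divide_eq[OF \<delta>] by (auto simp: algebra_simps)
    moreover have "G n \<le> (x - 1) / \<delta> \<longleftrightarrow> w ^ n \<le> X" "G n < (x - 1) / \<delta> \<longleftrightarrow> w ^ n < X"
      unfolding G_def X_def using w by (auto simp only: pos_divide_le_eq pos_divide_less_eq diff_gt_0_iff_gt)
    moreover have "w ^ n \<le> X \<longleftrightarrow> real n * ln w \<le> ln X" "w ^ n < X \<longleftrightarrow> real n * ln w < ln X"
      using w X ln_le_cancel_iff[of "w ^ n" X] ln_less_cancel_iff[of "w ^ n" X] by (simp_all add: ln_realpow)
    moreover have "0 < ln w" using w by simp
    ultimately show "level \<delta> n \<le> x \<longleftrightarrow> real n \<le> mt" "level \<delta> n < x \<longleftrightarrow> real n < mt"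
      unfolding mt by (simp_all add: pos_le_divide_eq pos_less_divide_eq)
  qed
  have mt_nonneg: "0 \<le> mt"
    using X w by (simp add: mt)
  have level_pos: "0 < level \<delta> n" for n
    using level_ge_one[OF \<delta>, of n] by linarith
  have idle: "queue_prob \<alpha> S \<delta> n 0 0 = 1 / level \<delta> n" for n
    using queue_prob_0[OF \<delta> mean] by (simp add: inv_idle_0[OF \<delta>])
  define m where "m = nat \<lfloor>mt\<rfloor>"
  have m: "real m \<le> mt" "mt < real (Suc m)"
    unfolding m_def using mt_nonneg by (simp, simp, linarith)
  have "x \<le> level \<delta> (nat \<lceil>mt\<rceil>)"
    using iff(2)[of "nat \<lceil>mt\<rceil>"] of_nat_ceiling[of mt] by linarith
  then have "1 / level \<delta> (nat \<lceil>mt\<rceil>) \<le> 1 / x"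
    using x(3) by (intro frac_le) auto
  moreover have "1 / x \<le> 1 / level \<delta> m"
    using iff(1)[of m] m(1) level_pos[of m] by (intro frac_le) auto
  ultimately have interval: "1 - lam \<in> {queue_prob \<alpha> S \<delta> (nat \<lceil>mt\<rceil>) 0 0 .. queue_prob \<alpha> S \<delta> (nat \<lfloor>mt\<rfloor>) 0 0}"
    by (simp add: idle x(2) flip: m_def)
  have "level \<delta> m \<le> x" "x < level \<delta> (Suc m)"
    using iff(1)[of m] iff(1)[of "Suc m"] m by auto
  then obtain \<nu> where \<nu>: "0 \<le> \<nu>" "inv_idle \<delta> m \<nu> = x"
    using ex_inv_idle[OF \<delta>] by blast
  have idle_iff: "queue_prob \<alpha> S \<delta> n \<nu>' 0 = 1 - lam \<longleftrightarrow> inv_idle \<delta> n \<nu>' = x" if "0 \<le> \<nu>'" for n \<nu>'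
    using queue_prob_0[OF \<delta> mean that] inv_idle_pos[OF \<delta> that, of n] x(3) by (auto simp: x(2) field_simps)
  have "cavity_params \<alpha> S \<delta> lam = (m, \<nu>)"
    unfolding cavity_params_def
  proof (rule the_equality)
    show "case (m, \<nu>) of (m, \<nu>) \<Rightarrow> 0 \<le> \<nu> \<and> queue_prob \<alpha> S \<delta> m \<nu> 0 = 1 - lam"
      using \<nu> idle_iff by simp
  next
    fix z assume z: "case z of (m, \<nu>) \<Rightarrow> 0 \<le> \<nu> \<and> queue_prob \<alpha> S \<delta> m \<nu> 0 = 1 - lam"
    obtain n \<nu>' where z_eq: "z = (n, \<nu>')" by (cases z)
    with z idle_iff have \<nu>': "0 \<le> \<nu>'" "inv_idle \<delta> n \<nu>' = x" by auto
    \<comment> \<open>The half-open intervals between consecutive levels are disjoint, so any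
      solution has the index \<open>m\<close>.\<close>
    then have "real n \<le> mt" "mt < real (Suc n)"
      using level_le_inv_idle[OF \<delta> \<nu>'(1), of n] inv_idle_less_level[OF \<delta> \<nu>'(1), of n] iff(1)[of n] iff(1)[of "Suc n"]
      by auto
    with m have "n = m" by linarith
    with \<nu> \<nu>' have "\<nu>' = \<nu>"
      using inv_idle_less[OF \<delta>, of \<nu> \<nu>' m] inv_idle_less[OF \<delta>, of \<nu>' \<nu> m] by (cases \<nu> \<nu>' rule: linorder_cases) auto
    with z_eq \<open>n = m\<close> show "z = (m, \<nu>)" by simp
  qed
  then have max: "cavity_max_queue \<alpha> S \<delta> lam = (if \<nu> = 0 then m else m + 1)"
    by (simp add: cavity_max_queue_def Greatest_queue_prob_pos[OF \<delta> mean \<nu>(1)])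
  \<comment> \<open>The case \<open>\<nu> = 0\<close> means that \<open>x\<close> is the left
    endpoint \<open>level \<delta> m\<close>, that is, \<open>mt\<close> is the integer
    \<open>m\<close>.\<close>
  have "\<lceil>mt\<rceil> = int (if \<nu> = 0 then m else m + 1)"
  proof (cases "\<nu> = 0")
    case True
    then have "mt = real m"
      using \<nu>(2) iff(2)[of m] m(1) by (simp add: inv_idle_0[OF \<delta>])
    with True show ?thesis by simp
  next
    case False
    then have "level \<delta> m < x"
      using \<nu> inv_idle_less[OF \<delta>, of 0 \<nu> m] by (simp add: inv_idle_0[OF \<delta>])
    with False m show ?thesis
      by (simp add: iff(2) ceiling_eq_iff)
  qed
  with mt_nonneg interval max show ?thesis by simp
qed

end
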